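(* Let $\nu$ be a Borel probability measure on $\mathbb{R}^d$ whose support lies in the interior of $[0,1]^d$, and assume that there are $a>0$ and $C\ge1$ with $\nu(Q)\le C2^{-ak}$ for all $Q\in\mathcal D_k$, $k\ge0$. Let $0<t<1$, and let $C_1\ge1$ be a constant depending only on $a,C,d$ such that $M_\nu(t)\le C_1t^{-1}(1+\log(1/t))$ for all $0<t<1$ (for instance $C_1=2^d\max\{1+(\log C)/a,\,1/a\}$). Then $$\log(1/t)\le\mathcal H_\nu(t)\le\log M_\nu(t)\le\log(1/t)+\log\bigl(C_1(1+\log(1/t))\bigr),$$ consequently $$0\le R_\nu(t)-\frac{\log(1/t)}{\mathcal L_\nu(t)}\le d\,\frac{\log\bigl(C_1(1+\log(1/t))\bigr)}{\log(1/t)}\longrightarrow0\quad(t\downarrow0),$$ and $$\underline D_0(\nu)=\liminf_{t\downarrow0}R_\nu(t),\qquad \overline D_0(\nu)=\limsup_{t\downarrow0}R_\nu(t),$$ where $t\downarrow0$ may be replaced by $t=N^{-c}$, $N\to\infty$, for any fixed $c>0$.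
   Context: $\log$ is the logarithm to base 2 and $\ln$ the natural logarithm; $\mathbb{R}^d$ carries the maximum norm. $\mathcal D_k$ is the partition of the root cube $[0,1]^d$ into $2^{dk}$ dyadic cubes of side length $2^{-k}$ (half-open cubes, with the outer boundary faces of $[0,1]^d$ assigned to the adjacent end cubes, so that the partitions are disjoint and nested, $\mathcal D_0=\{[0,1]^d\}$); $\mathcal D=\bigcup_{k\ge0}\mathcal D_k$; $\ell(Q)=2^{-k}$ for $Q\in\mathcal D_k$; $Q^-$ is the immediate dyadic parent of $Q$. For $0<t<1$: $P_\nu(t)=\{Q\in\mathcal D\setminus\mathcal D_0:0<\nu(Q)<t\le\nu(Q^-)\}$, $M_\nu(t)=\#P_\nu(t)$, $\mathcal L_\nu(t)=-\sum_{Q\in P_\nu(t)}\nu(Q)\log\ell(Q)$, $\mathcal H_\nu(t)=-\sum_{Q\in P_\nu(t)}\nu(Q)\log\nu(Q)$, $R_\nu(t)=\mathcal H_\nu(t)/\mathcal L_\nu(t)$. Quantization: $\mathfrak e_{N,0}(\nu)=\inf_{1\le\#A\le N}\exp\bigl(\int\ln d(x,A)\,d\nu(x)\bigr)$, infimum over non-empty finite $A\subset\mathbb{R}^d$, $d(x,A)=\inf_{y\in A}\|x-y\|_\infty$; $\underline D_0(\nu)$ and $\overline D_0(\nu)$ are the lower and upper limits of $\frac{\log N}{-\log\mathfrak e_{N,0}(\nu)}$ as $N\to\infty$. *)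

theory Defs
  imports "HOL-Probability.Probability"
begin

section \<open>Support and dyadic cubes\<close>

definition msupport :: "'a::topological_space measure \<Rightarrow> 'a set" where
  "msupport \<nu> = {x. \<forall>U. open U \<longrightarrow> x \<in> U \<longrightarrow> emeasure \<nu> U > 0}"

definition root_cube :: "(real ^ 'n) set" where
  "root_cube = {x. \<forall>i. 0 \<le> x $ i \<and> x $ i \<le> 1}"

text \<open>
  Left-closed, right-open dyadic intervals of generation \<open>k\<close>, except that the last one is closed,
  so that for every \<open>k\<close> they partition the closed unit interval.
\<close>

definition dyadic_interval :: "nat \<Rightarrow> nat \<Rightarrow> real set" where
  "dyadic_interval k j =
     (if j = 2 ^ k - 1 then {real j / 2 ^ k .. 1} else {real j / 2 ^ k ..< (real j + 1) / 2 ^ k})"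

definition dyadic_cubes :: "nat \<Rightarrow> (real ^ 'n) set set" where
  "dyadic_cubes k =
     {{x. \<forall>i. x $ i \<in> dyadic_interval k (z i)} | z :: 'n \<Rightarrow> nat. \<forall>i. z i < 2 ^ k}"

definition all_dyadic_cubes :: "(real ^ 'n) set set" where
  "all_dyadic_cubes = (\<Union>k. dyadic_cubes k)"

text \<open>
  Cubes of different generations differ as sets, since their side lengths do, and every cube of
  generation \<open>k > 0\<close> lies in exactly one cube of generation \<open>k - 1\<close>; hence both descriptions
  below are definite.
\<close>

definition cube_level :: "(real ^ 'n) set \<Rightarrow> nat" where
  "cube_level Q = (THE k. Q \<in> dyadic_cubes k)"

definition side_length :: "(real ^ 'n) set \<Rightarrow> real" where
  "side_length Q = 1 / 2 ^ cube_level Q"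

definition dyadic_parent :: "(real ^ 'n) set \<Rightarrow> (real ^ 'n) set" where
  "dyadic_parent Q = (THE Q'. Q' \<in> dyadic_cubes (cube_level Q - 1) \<and> Q \<subseteq> Q')"

section \<open>The threshold partition and its functionals\<close>

definition thr_partition :: "(real ^ 'n) measure \<Rightarrow> real \<Rightarrow> (real ^ 'n) set set" where
  "thr_partition \<nu> t =
     {Q \<in> all_dyadic_cubes - dyadic_cubes 0.
        0 < measure \<nu> Q \<and> measure \<nu> Q < t \<and> t \<le> measure \<nu> (dyadic_parent Q)}"

definition thr_card :: "(real ^ 'n) measure \<Rightarrow> real \<Rightarrow> nat" where
  "thr_card \<nu> t = card (thr_partition \<nu> t)"

definition thr_lyapunov :: "(real ^ 'n) measure \<Rightarrow> real \<Rightarrow> real" where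
  "thr_lyapunov \<nu> t = - (\<Sum>Q\<in>thr_partition \<nu> t. measure \<nu> Q * log 2 (side_length Q))"

definition thr_entropy :: "(real ^ 'n) measure \<Rightarrow> real \<Rightarrow> real" where
  "thr_entropy \<nu> t = - (\<Sum>Q\<in>thr_partition \<nu> t. measure \<nu> Q * log 2 (measure \<nu> Q))"

definition thr_ratio :: "(real ^ 'n) measure \<Rightarrow> real \<Rightarrow> real" where
  "thr_ratio \<nu> t = thr_entropy \<nu> t / thr_lyapunov \<nu> t"

section \<open>Geometric mean quantization error and dimensions\<close>

definition max_setdist :: "real ^ 'n \<Rightarrow> (real ^ 'n) set \<Rightarrow> real" where
  "max_setdist x A = (INF y\<in>A. infnorm (x - y))"

text \<open>
  The exponential of the integral of the logarithmic distance to a non-empty finite set \<open>A\<close>.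
  For boundedly supported \<open>\<nu>\<close> the distance is bounded almost everywhere, so the integral exists
  in the extended sense, and it is minus infinity exactly when \<open>A\<close> carries mass (where
  \<open>ln 0\<close> should be minus infinity, whereas HOL has \<open>ln 0 = 0\<close>) or the integrand is not
  integrable; the value is then \<open>0\<close>.
\<close>

definition geo_mean_dist :: "(real ^ 'n) measure \<Rightarrow> (real ^ 'n) set \<Rightarrow> real" where
  "geo_mean_dist \<nu> A =
     (if (AE x in \<nu>. max_setdist x A > 0) \<and> integrable \<nu> (\<lambda>x. ln (max_setdist x A))
      then exp (\<integral>x. ln (max_setdist x A) \<partial>\<nu>) else 0)"

definition quant_error0 :: "(real ^ 'n) measure \<Rightarrow> nat \<Rightarrow> real" where
  "quant_error0 \<nu> N = (INF A\<in>{A. finite A \<and> 1 \<le> card A \<and> card A \<le> N}. geo_mean_dist \<nu> A)"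

text \<open>
  If the error vanishes, then \<open>log 2 0 = 0\<close> and \<open>x / 0 = 0\<close> give the quotient the value
  \<open>0\<close>, as the convention \<open>- log 0 = \<infinity>\<close> does.
\<close>

definition lower_quant_dim0 :: "(real ^ 'n) measure \<Rightarrow> ereal" where
  "lower_quant_dim0 \<nu> = liminf (\<lambda>N. ereal (log 2 (real N) / - log 2 (quant_error0 \<nu> N)))"

definition upper_quant_dim0 :: "(real ^ 'n) measure \<Rightarrow> ereal" where
  "upper_quant_dim0 \<nu> = limsup (\<lambda>N. ereal (log 2 (real N) / - log 2 (quant_error0 \<nu> N)))"

end

theory Submission
  imports Defs "HOL-Real_Asymp.Real_Asymp"
begin

text \<open>
  Let \<open>\<kappa>\<^sub>t(x)\<close> be the first generation at which the dyadic cube around \<open>x\<close> has mass below \<open>t\<close>.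
  Then \<open>L(t) = \<integral> \<kappa>\<^sub>t d\<nu>\<close>, which is monotone in \<open>t\<close>, and Gibbs' inequality against the volumes of the cubes
  gives \<open>log(1/t) \<le> H(t) \<le> d L(t)\<close>.  Choosing one point in every cube of the threshold partition
  shows \<open>- log e\<^sub>N \<ge> L(t)\<close> as soon as \<open>M(t) \<le> N\<close>, for example for \<open>t = N\<^sup>-\<^sup>s\<close> with \<open>s < 1\<close> and \<open>N\<close> large.
  Conversely, for every \<open>A\<close> with at most \<open>N\<close> points, \<open>- log d(x,A)\<close> exceeds \<open>\<kappa>\<^sub>t(x)\<close> by at most the
  number of \<open>m \<ge> \<kappa>\<^sub>t(x)\<close> with \<open>d(x,A) < 2\<^sup>-\<^sup>m\<close>.  The points counted for \<open>m\<close> lie in at most \<open>3\<^sup>d N\<close>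
  cubes, each of mass at most \<open>min(t, C 2\<^sup>-\<^sup>a\<^sup>m)\<close>, so that for \<open>t = N\<^sup>-\<^sup>s\<close> with \<open>s > 1\<close> the total excess
  tends to \<open>0\<close> and \<open>- log e\<^sub>N \<le> L(t) + 1\<close>.  Letting \<open>s\<close> tend to \<open>1\<close> identifies the limits of
  \<open>log N / (- log e\<^sub>N)\<close> with those of \<open>log(1/t) / L(t)\<close>.
\<close>

section \<open>Dyadic cubes as cells of the index map\<close>

text \<open>The value at \<open>1\<close> matches the closed last interval of
  \<open>dyadic_interval\<close>; the floor alone would give \<open>2 ^ k\<close>, which is no
  admissible index.\<close>

definition dyadic_index :: "nat \<Rightarrow> real \<Rightarrow> nat" where
  "dyadic_index k x = (if x = 1 then 2 ^ k - 1 else nat \<lfloor>2 ^ k * x\<rfloor>)"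

lemma dyadic_index_less:
  assumes "0 \<le> x" "x \<le> 1"
  shows "dyadic_index k x < 2 ^ k"
proof (cases "x = 1")
  case False
  then have "2 ^ k * x < 2 ^ k" using assms by simp
  then have "\<lfloor>2 ^ k * x\<rfloor> < 2 ^ k" by (simp add: floor_less_iff)
  then show ?thesis using False assms
    by (simp add: dyadic_index_def nat_less_iff)
qed (simp add: dyadic_index_def)

lemma real_Suc_le_power_of_2: "real j + 1 \<le> 2 ^ k" if "j < 2 ^ k"
  using that by (metis Suc_leI of_nat_Suc of_nat_le_iff of_nat_numeral of_nat_power add.commute)

text \<open>Which end points belong to the interval depends on whether it is the last one. The two
  inclusions hide this wherever only containment or volume counts.\<close>

lemma dyadic_interval_bounds:
  assumes "j < 2 ^ k"
  shows "{real j / 2 ^ k <..< (real j + 1) / 2 ^ k} \<subseteq> dyadic_interval k j"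
    and "dyadic_interval k j \<subseteq> {real j / 2 ^ k .. (real j + 1) / 2 ^ k}"
proof -
  have "(real j + 1) / 2 ^ k = 1" if "j = 2 ^ k - 1"
    using that by (simp add: of_nat_diff)
  then show "{real j / 2 ^ k <..< (real j + 1) / 2 ^ k} \<subseteq> dyadic_interval k j"
    and "dyadic_interval k j \<subseteq> {real j / 2 ^ k .. (real j + 1) / 2 ^ k}"
    unfolding dyadic_interval_def by (auto simp del: of_nat_diff)
qed

lemma dyadic_interval_subset:
  assumes "j < 2 ^ k" shows "dyadic_interval k j \<subseteq> {0..1}"
proof -
  have "(real j + 1) / 2 ^ k \<le> 1" "0 \<le> real j / 2 ^ k"
    using real_Suc_le_power_of_2[OF assms] by auto
  then show ?thesis using dyadic_interval_bounds(2)[OF assms] by (meson atLeastatMost_subset_iff order_trans)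
qed

lemma mem_dyadic_interval_iff:
  assumes "0 \<le> x" "x \<le> 1" "j < 2 ^ k"
  shows "x \<in> dyadic_interval k j \<longleftrightarrow> dyadic_index k x = j"
proof -
  have j1: "real j + 1 \<le> 2 ^ k" using assms real_Suc_le_power_of_2 by blast
  show ?thesis
  proof (cases "x = 1")
    case True
    then have "dyadic_index k x = j \<longleftrightarrow> j = 2 ^ k - 1" by (auto simp: dyadic_index_def)
    moreover have "x \<in> dyadic_interval k j \<longleftrightarrow> j = 2 ^ k - 1"
      using j1 True by (auto simp: dyadic_interval_def field_simps)
    ultimately show ?thesis by simp
  next
    case False
    then have x: "x < 1" using assms by simp
    have "dyadic_index k x = j \<longleftrightarrow> \<lfloor>2 ^ k * x\<rfloor> = int j"
      using False assms by (auto simp: dyadic_index_def)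
    also have "\<dots> \<longleftrightarrow> real j \<le> 2 ^ k * x \<and> 2 ^ k * x < real j + 1"
      by (simp add: floor_eq_iff)
    also have "\<dots> \<longleftrightarrow> x \<in> dyadic_interval k j"
    proof (cases "j = 2 ^ k - 1")
      case True
      then have "real j + 1 = 2 ^ k" by (simp add: of_nat_diff)
      then show ?thesis using x True by (auto simp: dyadic_interval_def field_simps)
    next
      case False
      then show ?thesis using x by (auto simp: dyadic_interval_def field_simps)
    qed
    finally show ?thesis by simp
  qed
qed

text \<open>Halving the index passes to the parent interval, also at \<open>x = 1\<close>, where
  \<open>(2 ^ Suc k - 1) div 2 = 2 ^ k - 1\<close>. The nesting of the cubes rests on this.\<close>

lemma dyadic_index_Suc:
  assumes "0 \<le> x" "x \<le> 1"
  shows "dyadic_index (Suc k) x div 2 = dyadic_index k x"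
proof (cases "x = 1")
  case False
  have "\<lfloor>2 ^ Suc k * x\<rfloor> div 2 = \<lfloor>2 ^ k * x\<rfloor>"
    using floor_divide_real_eq_div[of 2 "2 ^ Suc k * x"] by simp
  moreover have "nat \<lfloor>2 ^ Suc k * x\<rfloor> div 2 = nat (\<lfloor>2 ^ Suc k * x\<rfloor> div 2)"
    using assms by (simp add: nat_div_distrib)
  ultimately show ?thesis using False by (simp add: dyadic_index_def)
qed (simp add: dyadic_index_def)

text \<open>The second bound cannot be strict: \<open>x = 1\<close> attains it.\<close>

lemma dyadic_index_bounds:
  assumes "0 \<le> x" "x \<le> 1"
  shows "real (dyadic_index k x) \<le> 2 ^ k * x" "2 ^ k * x \<le> real (dyadic_index k x) + 1"
proof -
  have "x \<in> dyadic_interval k (dyadic_index k x)"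
    using mem_dyadic_interval_iff dyadic_index_less assms by blast
  moreover have "2 ^ k \<le> real (2 ^ k - Suc 0) + 1" by (simp add: of_nat_diff)
  ultimately show "real (dyadic_index k x) \<le> 2 ^ k * x" "2 ^ k * x \<le> real (dyadic_index k x) + 1"
    using assms by (auto simp: dyadic_interval_def field_simps split: if_splits)
qed

text \<open>Naming a cube by one of its points makes the cubes of a generation equivalence classes,
  so that disjointness and nesting become equalities of indices. The form is meaningful for
  \<open>x\<close> in the root cube.\<close>

definition cube_at :: "nat \<Rightarrow> real ^ 'n \<Rightarrow> (real ^ 'n) set" where
  "cube_at k x = {y \<in> root_cube. \<forall>i. dyadic_index k (y $ i) = dyadic_index k (x $ i)}"

text \<open>The form in which \<open>dyadic_cubes\<close> presents its members; counting and volume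
  computations go through it.\<close>

definition index_cube :: "nat \<Rightarrow> ('n \<Rightarrow> nat) \<Rightarrow> (real ^ 'n) set" where
  "index_cube k z = {x. \<forall>i. x $ i \<in> dyadic_interval k (z i)}"

lemma cube_at_eq_index_cube:
  assumes "x \<in> root_cube"
  shows "cube_at k x = index_cube k (\<lambda>i. dyadic_index k (x $ i))"
proof -
  have less: "dyadic_index k (x $ i) < 2 ^ k" for i
    using assms dyadic_index_less by (auto simp: root_cube_def)
  have "y \<in> cube_at k x \<longleftrightarrow> y \<in> index_cube k (\<lambda>i. dyadic_index k (x $ i))" for y
  proof (cases "y \<in> root_cube")
    case True
    then have "y $ i \<in> dyadic_interval k (dyadic_index k (x $ i))
        \<longleftrightarrow> dyadic_index k (y $ i) = dyadic_index k (x $ i)" for i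
      using mem_dyadic_interval_iff less by (simp add: root_cube_def)
    then show ?thesis using True by (simp add: cube_at_def index_cube_def)
  next
    case False
    then show ?thesis using dyadic_interval_subset[OF less]
      by (fastforce simp: cube_at_def index_cube_def root_cube_def)
  qed
  then show ?thesis by blast
qed

lemma index_cube_eq_cube_at:
  fixes z :: "'n::finite \<Rightarrow> nat"
  assumes "\<And>i. z i < 2 ^ k"
  shows "\<exists>x \<in> root_cube. index_cube k z = cube_at k x"
proof -
  \<comment> \<open>The corner with the smallest coordinates lies in the cube, because all intervals
    are closed on the left.\<close>
  define x :: "real ^ 'n" where "x = (\<chi> i. real (z i) / 2 ^ k)"
  have z1: "real (z i) + 1 \<le> 2 ^ k" for i using assms[of i] real_Suc_le_power_of_2 by blast
  have x: "0 \<le> x $ i" "x $ i \<le> 1" for i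
  proof -
    have "real (z i) \<le> 2 ^ k" using z1[of i] by linarith
    then have "real (z i) / 2 ^ k \<le> 1" by (subst divide_le_eq_1_pos) auto
    then show "x $ i \<le> 1" by (simp only: x_def vec_lambda_beta)
  qed (simp add: x_def)
  then have root: "x \<in> root_cube" by (simp add: root_cube_def)
  have "x $ i \<in> dyadic_interval k (z i)" for i
    using z1[of i] by (auto simp: x_def dyadic_interval_def field_simps)
  then have "dyadic_index k (x $ i) = z i" for i
    using mem_dyadic_interval_iff assms x by blast
  then have "index_cube k z = cube_at k x" using cube_at_eq_index_cube[OF root, of k] by simp
  then show ?thesis using root by blast
qed

lemma dyadic_cubes_eq: "dyadic_cubes k = cube_at k ` root_cube"
proof -
  have "dyadic_cubes k = index_cube k ` {z. \<forall>i. z i < 2 ^ k}"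
    by (auto simp: dyadic_cubes_def index_cube_def)
  also have "\<dots> = cube_at k ` root_cube"
  proof (intro antisym subsetI)
    fix Q :: "(real ^ 'n) set" assume "Q \<in> index_cube k ` {z. \<forall>i. z i < 2 ^ k}"
    then show "Q \<in> cube_at k ` root_cube" using index_cube_eq_cube_at by fastforce
  next
    fix Q :: "(real ^ 'n) set" assume "Q \<in> cube_at k ` root_cube"
    then obtain x where x: "x \<in> root_cube" "Q = cube_at k x" by auto
    then have "\<forall>i. dyadic_index k (x $ i) < 2 ^ k"
      using dyadic_index_less by (auto simp: root_cube_def)
    then show "Q \<in> index_cube k ` {z. \<forall>i. z i < 2 ^ k}"
      using x cube_at_eq_index_cube by blast
  qed
  finally show ?thesis .
qed

lemma finite_dyadic_cubes: "finite (dyadic_cubes k :: (real ^ 'n) set set)"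
proof -
  have "(dyadic_cubes k :: (real ^ 'n) set set) = index_cube k ` (PiE UNIV (\<lambda>_. {..<2 ^ k}))"
    by (auto simp: dyadic_cubes_def index_cube_def PiE_def Pi_def)
moreover have "finite (PiE (UNIV :: 'n set) (\<lambda>_. {..<(2::nat) ^ k}))" by (intro finite_PiE) auto
  ultimately show ?thesis by (metis finite_imageI)
qed

lemma finite_dyadic_cubes_Collect [simp]: "finite {Q \<in> dyadic_cubes k. P Q}"
  using finite_dyadic_cubes by (rule finite_subset[rotated]) auto

section \<open>Nesting of the cubes around a point\<close>

lemma cube_at_self: "x \<in> root_cube \<Longrightarrow> x \<in> cube_at k x"
  by (simp add: cube_at_def)

lemma cube_at_subset_root: "cube_at k x \<subseteq> root_cube"
  by (auto simp: cube_at_def)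

lemma cube_at_eq: "y \<in> cube_at k x \<Longrightarrow> cube_at k y = cube_at k x"
  by (auto simp: cube_at_def)

lemma cube_at_0: "cube_at 0 x = root_cube"
  if "x \<in> root_cube"
  using that dyadic_index_less[of _ 0] by (fastforce simp: cube_at_def root_cube_def)

lemma cube_at_Suc_subset:
  assumes "x \<in> root_cube" shows "cube_at (Suc k) x \<subseteq> cube_at k x"
  using assms dyadic_index_Suc unfolding cube_at_def root_cube_def
  by clarsimp metis

lemma cube_at_antimono:
  assumes "x \<in> root_cube" "k \<le> m" shows "cube_at m x \<subseteq> cube_at k x"
  using assms(2) by (induction m rule: dec_induct) (use cube_at_Suc_subset[OF assms(1)] in auto)

section \<open>The maximum norm and counting of cubes\<close>

lemma infnorm_le_iff: "infnorm (x :: real ^ 'n) \<le> e \<longleftrightarrow> (\<forall>i. \<bar>x $ i\<bar> \<le> e)"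
proof
  assume "infnorm x \<le> e"
  then show "\<forall>i. \<bar>x $ i\<bar> \<le> e" using component_le_infnorm_cart order_trans by blast
next
  assume *: "\<forall>i. \<bar>x $ i\<bar> \<le> e"
  have "{\<bar>x $ i\<bar> |i. i \<in> UNIV} \<noteq> {}" by blast
  then show "infnorm x \<le> e" unfolding infnorm_cart using * by (intro cSup_least) auto
qed

text \<open>In the maximum norm no dimensional factor enters, so a single point approximates its
  whole cube within the side length.\<close>

lemma infnorm_cube_at_le:
  assumes "x \<in> root_cube" "y \<in> cube_at k x" shows "infnorm (x - y) \<le> 1 / 2 ^ k"
  unfolding infnorm_le_iff
proof
  fix i
  have "dyadic_index k (y $ i) = dyadic_index k (x $ i)" "0 \<le> x $ i" "x $ i \<le> 1" "0 \<le> y $ i" "y $ i \<le> 1"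
    using assms by (auto simp: cube_at_def root_cube_def)
  then have "\<bar>2 ^ k * x $ i - 2 ^ k * y $ i\<bar> \<le> 1"
    using dyadic_index_bounds[of "x $ i" k] dyadic_index_bounds[of "y $ i" k] by linarith
  moreover have "\<bar>2 ^ k * x $ i - 2 ^ k * y $ i\<bar> = 2 ^ k * \<bar>x $ i - y $ i\<bar>"
    by (simp add: abs_mult flip: right_diff_distrib)
  ultimately show "\<bar>(x - y) $ i\<bar> \<le> 1 / 2 ^ k" by (simp add: field_simps)
qed

text \<open>A cube is determined by its index vector, so a product of sets of possible indices
  bounds the number of cubes. Both the children of a cube and the cubes near a point are counted
  this way.\<close>

lemma card_cubes_le:
  fixes S :: "(real ^ 'n) set set" and J :: "'n \<Rightarrow> nat set"
  assumes "S \<subseteq> dyadic_cubes k"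
    and J: "\<And>x i. x \<in> root_cube \<Longrightarrow> cube_at k x \<in> S \<Longrightarrow> dyadic_index k (x $ i) \<in> J i"
    and fin: "\<And>i. finite (J i)" and card: "\<And>i. card (J i) \<le> b"
  shows "card S \<le> b ^ CARD('n)"
proof -
  have "S \<subseteq> index_cube k ` PiE UNIV J"
  proof
    fix Q assume "Q \<in> S"
    then obtain x where x: "x \<in> root_cube" "Q = cube_at k x" using assms(1) dyadic_cubes_eq by blast
    then have "(\<lambda>i. dyadic_index k (x $ i)) \<in> PiE UNIV J" using J \<open>Q \<in> S\<close> by auto
    then show "Q \<in> index_cube k ` PiE UNIV J" using x cube_at_eq_index_cube by blast
  qed
  then have "card S \<le> card (index_cube k ` PiE UNIV J :: (real ^ 'n) set set)"
    using fin by (intro card_mono finite_imageI finite_PiE) auto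
  also have "\<dots> \<le> card (PiE UNIV J)" using fin by (intro card_image_le finite_PiE) auto
  also have "\<dots> = (\<Prod>i\<in>UNIV. card (J i))" by (simp add: card_PiE)
  also have "\<dots> \<le> (\<Prod>i\<in>(UNIV::'n set). b)" using card by (intro prod_mono) auto
  finally show ?thesis by simp
qed

lemma card_children_le:
  fixes x :: "real ^ 'n"
  shows "card {cube_at (Suc k) y |y. y \<in> cube_at k x} \<le> 2 ^ CARD('n)"
proof (rule card_cubes_le[where k = "Suc k"])
  show "{cube_at (Suc k) y |y. y \<in> cube_at k x} \<subseteq> dyadic_cubes (Suc k)"
    using cube_at_subset_root by (auto simp: dyadic_cubes_eq)
  \<comment> \<open>By \<open>dyadic_index_Suc\<close> these are the only indices whose half is the
    index of the parent.\<close>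
  let ?J = "\<lambda>i. {2 * dyadic_index k (x $ i), Suc (2 * dyadic_index k (x $ i))}"
  fix y :: "real ^ 'n" and i
  assume y: "y \<in> root_cube" "cube_at (Suc k) y \<in> {cube_at (Suc k) y |y. y \<in> cube_at k x}"
  then obtain w where w: "w \<in> cube_at k x" "cube_at (Suc k) y = cube_at (Suc k) w" by blast
  then have "y \<in> cube_at (Suc k) w" using y cube_at_self by blast
  then have "dyadic_index (Suc k) (y $ i) = dyadic_index (Suc k) (w $ i)" by (simp add: cube_at_def)
  moreover have "dyadic_index (Suc k) (w $ i) div 2 = dyadic_index k (x $ i)"
    using w(1) dyadic_index_Suc by (simp add: cube_at_def root_cube_def)
  ultimately show "dyadic_index (Suc k) (y $ i) \<in> ?J i" by auto
qed auto

lemma card_near_cubes_le: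
  fixes y :: "real ^ 'n"
  shows "card {Q \<in> dyadic_cubes k. \<exists>x\<in>Q. infnorm (x - y) < 1 / 2 ^ k} \<le> 3 ^ CARD('n)"
proof (rule card_cubes_le[where k = k])
  \<comment> \<open>If \<open>w\<close> lies in the cube and within \<open>1 / 2 ^ k\<close> of
    \<open>y\<close>, then \<open>2 ^ k * w $ i\<close> lies between \<open>j\<close> and
    \<open>j + 1\<close> and within \<open>1\<close> of \<open>2 ^ k * y $ i\<close>. This leaves an
    open interval of length \<open>3\<close>, hence at most three integers.\<close>
  let ?J = "\<lambda>i. {j::nat. 2 ^ k * y $ i - 2 < real j \<and> real j < 2 ^ k * y $ i + 1}"
  \<comment> \<open>Since \<open>y\<close> is arbitrary, the bounds may be negative, and the
    counting is done in the integers.\<close>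
  have sub: "int ` ?J i \<subseteq> {\<lfloor>2 ^ k * y $ i\<rfloor> - 1 .. \<lfloor>2 ^ k * y $ i\<rfloor> + 1}" for i
  proof
    fix m assume "m \<in> int ` ?J i"
    then have "2 ^ k * y $ i - 2 < of_int m" "of_int m < 2 ^ k * y $ i + 1" by auto
    then show "m \<in> {\<lfloor>2 ^ k * y $ i\<rfloor> - 1 .. \<lfloor>2 ^ k * y $ i\<rfloor> + 1}"
      by simp linarith
  qed
  show "finite (?J i)" for i
    using finite_subset[OF sub] by (simp add: finite_image_iff)
  have "card (?J i) = card (int ` ?J i)" for i by (simp add: card_image)
  also have "\<dots> i \<le> 3" for i using card_mono[OF _ sub[of i]] by simp
  finally show "card (?J i) \<le> 3" for i .
  fix x :: "real ^ 'n" and i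
  assume x: "x \<in> root_cube" "cube_at k x \<in> {Q \<in> dyadic_cubes k. \<exists>x\<in>Q. infnorm (x - y) < 1 / 2 ^ k}"
  then obtain w where w: "w \<in> cube_at k x" "infnorm (w - y) < 1 / 2 ^ k" by blast
  have "\<bar>w $ i - y $ i\<bar> < 1 / 2 ^ k"
    using component_le_infnorm_cart[of "w - y" i] w(2) by simp
  then have "2 ^ k * \<bar>w $ i - y $ i\<bar> < 1" by (simp add: field_simps)
  then have "\<bar>2 ^ k * w $ i - 2 ^ k * y $ i\<bar> < 1"
    by (simp add: abs_mult flip: right_diff_distrib)
  moreover have "dyadic_index k (x $ i) = dyadic_index k (w $ i)" "0 \<le> w $ i" "w $ i \<le> 1"
    using w(1) by (auto simp: cube_at_def root_cube_def)
  ultimately show "dyadic_index k (x $ i) \<in> ?J i"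
    using dyadic_index_bounds[of "w $ i" k] by simp linarith
qed blast

section \<open>Measurability, volume, generation and parent of a cube\<close>

lemma cube_at_borel [measurable]:
  fixes x :: "real ^ 'n"
  assumes "x \<in> root_cube" shows "cube_at k x \<in> sets borel"
proof -
  have iv: "dyadic_interval k j \<in> sets borel" for j by (simp add: dyadic_interval_def)
  have "{y. y $ i \<in> dyadic_interval k j} \<in> sets borel" for i :: 'n and j
    using measurable_sets[OF borel_measurable_nth iv, of i] by (simp add: vimage_def)
  then have "(\<Inter>i. {y. y $ i \<in> dyadic_interval k (dyadic_index k (x $ i))}) \<in> sets borel"
    by (intro sets.countable_INT') auto
  moreover have "cube_at k x = (\<Inter>i. {y. y $ i \<in> dyadic_interval k (dyadic_index k (x $ i))})"
    unfolding cube_at_eq_index_cube[OF assms] index_cube_def by blast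
  ultimately show ?thesis by simp
qed

text \<open>The cube lies between an open box and its closure, which have equal volume, so the
  choice of faces has no influence.\<close>

lemma emeasure_lborel_cube_at:
  fixes x :: "real ^ 'n"
  assumes "x \<in> root_cube" shows "emeasure lborel (cube_at k x) = ennreal ((1 / 2 ^ k) ^ CARD('n))"
proof -
  define l u :: "real ^ 'n" where
    "l = (\<chi> i. real (dyadic_index k (x $ i)) / 2 ^ k)" and
    "u = (\<chi> i. (real (dyadic_index k (x $ i)) + 1) / 2 ^ k)"
  have lu: "l $ i \<le> u $ i" for i by (simp add: l_def u_def divide_right_mono)
  have less: "dyadic_index k (x $ i) < 2 ^ k" for i
    using assms dyadic_index_less by (auto simp: root_cube_def)
  have iv: "{l $ i <..< u $ i} \<subseteq> dyadic_interval k (dyadic_index k (x $ i))"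
    "dyadic_interval k (dyadic_index k (x $ i)) \<subseteq> {l $ i .. u $ i}" for i
    using dyadic_interval_bounds[OF less[of i]] by (simp_all add: l_def u_def)
  have sub1: "box l u \<subseteq> cube_at k x" and sub2: "cube_at k x \<subseteq> cbox l u"
    unfolding cube_at_eq_index_cube[OF assms] index_cube_def
    using iv by (fastforce simp: mem_box_cart)+
  have "measure lborel (cbox l u) = (\<Prod>i\<in>UNIV. u $ i - l $ i)"
    using lu by (intro content_cbox_cart) (simp add: interval_ne_empty_cart)
  also have "\<dots> = (1 / 2 ^ k) ^ CARD('n)"
    by (simp add: l_def u_def flip: diff_divide_distrib)
  finally have c: "emeasure lborel (cbox l u) = ennreal ((1 / 2 ^ k) ^ CARD('n))"
    using emeasure_eq_ennreal_measure[of lborel "cbox l u"] emeasure_lborel_cbox_finite[of l u] by simp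
  then have "emeasure lborel (box l u) = ennreal ((1 / 2 ^ k) ^ CARD('n))"
    by (metis emeasure_lborel_box_eq emeasure_lborel_cbox_eq)
  moreover have "emeasure lborel (box l u) \<le> emeasure lborel (cube_at k x)"
    using sub1 assms by (intro emeasure_mono) auto
  moreover have "emeasure lborel (cube_at k x) \<le> emeasure lborel (cbox l u)"
    using sub2 by (intro emeasure_mono) auto
  ultimately show ?thesis using c by (metis antisym)
qed

text \<open>The volume of a cube determines its generation, which gives the uniqueness behind the
  \<open>THE\<close> in \<open>cube_level\<close>.\<close>

lemma cube_level_cube_at:
  fixes x :: "real ^ 'n"
  assumes "x \<in> root_cube" shows "cube_level (cube_at k x) = k"
  unfolding cube_level_def
proof (rule the_equality)
  show "cube_at k x \<in> dyadic_cubes k" using assms by (simp add: dyadic_cubes_eq)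
  fix m assume "cube_at k x \<in> dyadic_cubes m"
  then obtain y where "y \<in> root_cube" "cube_at k x = cube_at m y" by (auto simp: dyadic_cubes_eq)
  then have "ennreal ((1 / 2 ^ k) ^ CARD('n)) = ennreal ((1 / 2 ^ m) ^ CARD('n))"
    using emeasure_lborel_cube_at assms by metis
  then have "(1 / 2 ^ k) ^ CARD('n) = ((1 / 2 ^ m) ^ CARD('n) :: real)" by simp
  then have "1 / 2 ^ k = (1 / 2 ^ m :: real)"
    by (rule power_eq_imp_eq_base) auto
  then show "m = k" by simp
qed

text \<open>Any candidate for the parent contains \<open>x\<close>, and \<open>x\<close> lies in
  just one cube of generation \<open>k\<close>.\<close>

lemma dyadic_parent_cube_at:
  assumes "x \<in> root_cube" shows "dyadic_parent (cube_at (Suc k) x) = cube_at k x"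
  unfolding dyadic_parent_def cube_level_cube_at[OF assms] diff_Suc_1
proof (rule the_equality)
  show "cube_at k x \<in> dyadic_cubes k \<and> cube_at (Suc k) x \<subseteq> cube_at k x"
    using assms cube_at_Suc_subset by (auto simp: dyadic_cubes_eq)
  fix Q assume "Q \<in> dyadic_cubes k \<and> cube_at (Suc k) x \<subseteq> Q"
  then show "Q = cube_at k x"
    using cube_at_self[OF assms] cube_at_eq by (fastforce simp: dyadic_cubes_eq)
qed

section \<open>Comparison of lower and upper limits\<close>

lemma Liminf_ereal_mono_eps:
  fixes u v :: "'a \<Rightarrow> real"
  assumes "F \<noteq> bot" "\<And>e. e > 0 \<Longrightarrow> eventually (\<lambda>x. u x \<le> v x + e) F"
  shows "Liminf F (\<lambda>x. ereal (u x)) \<le> Liminf F (\<lambda>x. ereal (v x))"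
proof (rule ereal_le_epsilon2)
  fix e :: real assume "e > 0"
  then have "Liminf F (\<lambda>x. ereal (u x)) \<le> Liminf F (\<lambda>x. ereal (v x) + ereal e)"
    using assms(2) by (intro Liminf_mono) simp
  also have "\<dots> = Liminf F (\<lambda>x. ereal (v x)) + ereal e"
    using assms(1) by (intro Liminf_add_ereal_right) auto
  finally show "Liminf F (\<lambda>x. ereal (u x)) \<le> Liminf F (\<lambda>x. ereal (v x)) + ereal e" .
qed

lemma Limsup_ereal_mono_eps:
  fixes u v :: "'a \<Rightarrow> real"
  assumes "F \<noteq> bot" "\<And>e. e > 0 \<Longrightarrow> eventually (\<lambda>x. u x \<le> v x + e) F"
  shows "Limsup F (\<lambda>x. ereal (u x)) \<le> Limsup F (\<lambda>x. ereal (v x))"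
proof (rule ereal_le_epsilon2)
  fix e :: real assume "e > 0"
  then have "Limsup F (\<lambda>x. ereal (u x)) \<le> Limsup F (\<lambda>x. ereal (v x) + ereal e)"
    using assms(2) by (intro Limsup_mono) simp
  also have "\<dots> = Limsup F (\<lambda>x. ereal (v x)) + ereal e"
    using assms(1) by (intro Limsup_add_ereal_right) auto
  finally show "Limsup F (\<lambda>x. ereal (u x)) \<le> Limsup F (\<lambda>x. ereal (v x)) + ereal e" .
qed

lemma Liminf_Limsup_eq_of_diff_tendsto_0:
  fixes u v :: "'a \<Rightarrow> real"
  assumes "F \<noteq> bot" "((\<lambda>x. u x - v x) \<longlongrightarrow> 0) F"
  shows "Liminf F (\<lambda>x. ereal (u x)) = Liminf F (\<lambda>x. ereal (v x))"
    and "Limsup F (\<lambda>x. ereal (u x)) = Limsup F (\<lambda>x. ereal (v x))"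
proof -
  have *: "eventually (\<lambda>x. \<bar>u x - v x\<bar> < e) F" if "e > 0" for e
    using tendstoD[OF assms(2) that] by (simp add: dist_real_def)
  have "eventually (\<lambda>x. u x \<le> v x + e) F" "eventually (\<lambda>x. v x \<le> u x + e) F" if "e > 0" for e
    using *[OF that] by (auto elim!: eventually_mono)
  then show "Liminf F (\<lambda>x. ereal (u x)) = Liminf F (\<lambda>x. ereal (v x))"
    and "Limsup F (\<lambda>x. ereal (u x)) = Limsup F (\<lambda>x. ereal (v x))"
    using assms(1) by (auto intro!: antisym Liminf_ereal_mono_eps Limsup_ereal_mono_eps)
qed

text \<open>Eventual bounds pull back along \<open>h\<close>. Below, \<open>h\<close> is either a
  power of \<open>N\<close> as a threshold or, conversely, an integer chosen from
  \<open>t\<close>.\<close>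

lemma Liminf_le_Liminf_compose:
  fixes f :: "'b \<Rightarrow> 'c :: complete_linorder"
  assumes "filterlim h G F"
  shows "Liminf G f \<le> Liminf F (\<lambda>x. f (h x))"
  unfolding le_Liminf_iff
proof (intro allI impI)
  fix y assume "y < Liminf G f"
  then have "eventually (\<lambda>x. y < f x) G" by (rule less_LiminfD)
  then show "eventually (\<lambda>x. y < f (h x)) F" using assms by (auto simp: filterlim_iff)
qed

lemma Limsup_compose_le_Limsup:
  fixes f :: "'b \<Rightarrow> 'c :: complete_linorder"
  assumes "filterlim h G F"
  shows "Limsup F (\<lambda>x. f (h x)) \<le> Limsup G f"
  unfolding Limsup_le_iff
proof (intro allI impI)
  fix y assume "Limsup G f < y"
  then have "eventually (\<lambda>x. f x < y) G" by (rule Limsup_lessD)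
  then show "eventually (\<lambda>x. f (h x) < y) F" using assms by (auto simp: filterlim_iff)
qed

section \<open>Thresholds that are powers of \<open>N\<close>\<close>

lemma filterlim_powr_at_right_0:
  "(c::real) > 0 \<Longrightarrow> filterlim (\<lambda>N. real N powr - c) (at_right 0) sequentially"
  by real_asymp

text \<open>Monotonicity of \<open>L\<close> lets \<open>t\<close> be compared with the neighbouring powers \<open>N powr - c\<close>;
  the error factor \<open>log 2 (N + 1) / log 2 N\<close> is harmless because the ratio is bounded by \<open>d\<close>.\<close>

lemma Liminf_Limsup_log_ratio_powr:
  fixes L :: "real \<Rightarrow> real"
  assumes "c > 0" "d > 0"
    and mono: "\<And>s t. 0 < s \<Longrightarrow> s \<le> t \<Longrightarrow> t < 1 \<Longrightarrow> L t \<le> L s"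
    and lower: "\<And>t. 0 < t \<Longrightarrow> t < 1 \<Longrightarrow> log 2 (1 / t) \<le> d * L t"
  defines "\<phi> \<equiv> \<lambda>t. log 2 (1 / t) / L t"
  shows "liminf (\<lambda>N. ereal (\<phi> (real N powr - c))) = Liminf (at_right 0) (\<lambda>t. ereal (\<phi> t))"
    and "limsup (\<lambda>N. ereal (\<phi> (real N powr - c))) = Limsup (at_right 0) (\<lambda>t. ereal (\<phi> t))"
proof -
  have Lpos: "L t > 0" if "0 < t" "t < 1" for t
  proof -
    have "0 < log 2 (1 / t)" using that by simp
    then have "0 < d * L t" using lower[OF that] by linarith
    then show ?thesis using \<open>d > 0\<close> by (simp add: zero_less_mult_iff)
  qed
  have bound: "0 \<le> \<phi> t" "\<phi> t \<le> d" if "0 < t" "t < 1" for t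
    using lower[OF that] Lpos[OF that] that unfolding \<phi>_def by (auto simp: field_simps)
  \<comment> \<open>Chosen so that \<open>t\<close> lies between
    \<open>real (Suc (n t)) powr - c\<close> and \<open>real (n t) powr - c\<close>.\<close>
  define n where "n = (\<lambda>t. nat \<lfloor>t powr (- (1 / c))\<rfloor>)"
  have n_lim: "filterlim n sequentially (at_right 0)"
    unfolding n_def using \<open>c > 0\<close> by real_asymp
  have n_Suc_lim: "filterlim (\<lambda>t. Suc (n t)) sequentially (at_right 0)"
    using filterlim_compose[OF filterlim_Suc n_lim] .
  define \<psi> where "\<psi> = (\<lambda>N. \<phi> (real N powr - c))"
  have ratio: "((\<lambda>N. log 2 (real (Suc N)) / log 2 (real N)) \<longlongrightarrow> 1) sequentially"
    "((\<lambda>N. log 2 (real N) / log 2 (real (Suc N))) \<longlongrightarrow> 1) sequentially"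
    by real_asymp+
  have n_bounds: "real (Suc (n t)) powr - c \<le> t" "t \<le> real (n t) powr - c"
    if "0 < t" "n t \<ge> 2" for t
  proof -
    have t: "t = (t powr (- (1 / c))) powr - c" using that \<open>c > 0\<close> by (simp add: powr_powr)
    have "real (n t) \<le> t powr (- (1 / c))" "t powr (- (1 / c)) \<le> real (Suc (n t))"
      unfolding n_def by (auto simp: of_nat_nat) linarith
    then show "real (Suc (n t)) powr - c \<le> t" "t \<le> real (n t) powr - c"
      using that \<open>c > 0\<close> by (subst t, intro powr_mono2', auto)+
  qed
  have logpow: "log 2 (1 / (real N powr - c)) = c * log 2 (real N)" if "N \<ge> 2" for N
    using that by (simp add: powr_minus log_powr inverse_eq_divide)
  have pow01: "0 < real N powr - c" "real N powr - c < 1" if "N \<ge> 2" for N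
    using that \<open>c > 0\<close> powr_less_one[of "real N" "- c"] by auto
  have n2: "eventually (\<lambda>t. 0 < t \<and> t < 1 \<and> 2 \<le> n t) (at_right 0)"
    using filterlim_at_top[THEN iffD1, OF n_lim, rule_format, of 2]
      eventually_at_right_real[OF zero_less_one]
    by eventually_elim auto
  \<comment> \<open>For an upper bound the numerator is taken at the smaller neighbouring power and
    the denominator \<open>L\<close> at the larger one; for a lower bound the roles are
    exchanged.\<close>
  have up: "\<phi> t \<le> \<psi> (n t) * (log 2 (real (Suc (n t))) / log 2 (real (n t)))"
    and low: "\<psi> (Suc (n t)) * (log 2 (real (n t)) / log 2 (real (Suc (n t)))) \<le> \<phi> t"
    if t: "0 < t" "t < 1" "2 \<le> n t" for t
  proof -
    let ?s = "real (n t) powr - c" and ?r = "real (Suc (n t)) powr - c"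
    have "log 2 (1 / t) \<le> log 2 (1 / ?r)" "log 2 (1 / ?s) \<le> log 2 (1 / t)"
      using n_bounds[of t] t pow01[of "n t"] pow01[of "Suc (n t)"] by (auto simp: log_divide simp del: of_nat_Suc)
    then have lg: "log 2 (1 / t) \<le> c * log 2 (real (Suc (n t)))" "c * log 2 (real (n t)) \<le> log 2 (1 / t)"
      using logpow[of "n t"] logpow[of "Suc (n t)"] t(3) by (auto simp del: of_nat_Suc)
    have L: "L ?s \<le> L t" "L t \<le> L ?r"
      using n_bounds t pow01[of "n t"] pow01[of "Suc (n t)"] by (auto intro!: mono simp del: of_nat_Suc)
    have pos: "L ?s > 0" "L t > 0" "L ?r > 0"
      using Lpos pow01[of "n t"] pow01[of "Suc (n t)"] t by (auto simp del: of_nat_Suc)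
    have lpos: "log 2 (real (n t)) > 0" "log 2 (real (Suc (n t))) > 0" "0 < log 2 (1 / t)"
      using t by auto
    have swap: "c * y / l = c * x / l * (y / x)" if "x > 0" for x y l :: real using that by simp
    have "\<phi> t \<le> (c * log 2 (real (Suc (n t)))) / L ?s"
      unfolding \<phi>_def using lg L pos lpos by (intro frac_le) auto
    also have "\<dots> = \<psi> (n t) * (log 2 (real (Suc (n t))) / log 2 (real (n t)))"
      unfolding \<psi>_def \<phi>_def logpow[OF t(3)] by (rule swap[OF lpos(1)])
    finally show "\<phi> t \<le> \<psi> (n t) * (log 2 (real (Suc (n t))) / log 2 (real (n t)))" .
    have "(c * log 2 (real (n t))) / L ?r \<le> \<phi> t"
      unfolding \<phi>_def using lg L pos lpos by (intro frac_le) auto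
    moreover have "(c * log 2 (real (n t))) / L ?r = \<psi> (Suc (n t)) * (log 2 (real (n t)) / log 2 (real (Suc (n t))))"
      unfolding \<psi>_def \<phi>_def logpow[OF le_SucI[OF t(3)]] by (rule swap[OF lpos(2)])
    ultimately show "\<psi> (Suc (n t)) * (log 2 (real (n t)) / log 2 (real (Suc (n t)))) \<le> \<phi> t" by simp
  qed
  have \<psi>: "0 \<le> \<psi> N" "\<psi> N \<le> d" if "N \<ge> 2" for N
    using bound pow01[OF that] by (auto simp: \<psi>_def)
  have up_eps: "eventually (\<lambda>t. \<phi> t \<le> \<psi> (n t) + e) (at_right 0)" if "e > 0" for e
  proof -
    have "eventually (\<lambda>N. \<bar>log 2 (real (Suc N)) / log 2 (real N) - 1\<bar> < e / d) sequentially"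
      using tendstoD[OF ratio(1), of "e / d"] that \<open>d > 0\<close> by (simp add: dist_real_def)
    then have "eventually (\<lambda>t. \<bar>log 2 (real (Suc (n t))) / log 2 (real (n t)) - 1\<bar> < e / d) (at_right 0)"
      using n_lim by (auto simp: filterlim_iff)
    with n2 show ?thesis
    proof eventually_elim
      case (elim t)
      let ?q = "log 2 (real (Suc (n t))) / log 2 (real (n t))"
      have "\<psi> (n t) * (?q - 1) \<le> d * (e / d)"
        using elim \<psi>[of "n t"] \<open>e > 0\<close> \<open>d > 0\<close>
        by (intro order_trans[OF mult_left_mono mult_right_mono]) auto
      then show ?case using up[of t] elim \<open>d > 0\<close> by (simp add: algebra_simps)
    qed
  qed
  have low_eps: "eventually (\<lambda>t. \<psi> (Suc (n t)) \<le> \<phi> t + e) (at_right 0)" if "e > 0" for e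
  proof -
    have "eventually (\<lambda>N. \<bar>log 2 (real N) / log 2 (real (Suc N)) - 1\<bar> < e / d) sequentially"
      using tendstoD[OF ratio(2), of "e / d"] that \<open>d > 0\<close> by (simp add: dist_real_def)
    then have "eventually (\<lambda>t. \<bar>log 2 (real (n t)) / log 2 (real (Suc (n t))) - 1\<bar> < e / d) (at_right 0)"
      using n_lim by (auto simp: filterlim_iff)
    with n2 show ?thesis
    proof eventually_elim
      case (elim t)
      let ?q = "log 2 (real (n t)) / log 2 (real (Suc (n t)))"
      have "\<psi> (Suc (n t)) * (1 - ?q) \<le> d * (e / d)"
        using elim \<psi>[of "Suc (n t)"] \<open>e > 0\<close> \<open>d > 0\<close>
        by (intro order_trans[OF mult_left_mono mult_right_mono]) auto
      then show ?case using low[of t] elim \<open>d > 0\<close> by (simp add: algebra_simps)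
    qed
  qed
  have nb: "at_right (0::real) \<noteq> bot" by simp
  show "liminf (\<lambda>N. ereal (\<phi> (real N powr - c))) = Liminf (at_right 0) (\<lambda>t. ereal (\<phi> t))"
  proof (rule antisym)
    have "liminf (\<lambda>N. ereal (\<psi> N)) \<le> Liminf (at_right 0) (\<lambda>t. ereal (\<psi> (Suc (n t))))"
      using Liminf_le_Liminf_compose[OF n_Suc_lim] .
    also have "\<dots> \<le> Liminf (at_right 0) (\<lambda>t. ereal (\<phi> t))"
      using Liminf_ereal_mono_eps[OF nb low_eps] .
    finally show "liminf (\<lambda>N. ereal (\<phi> (real N powr - c))) \<le> Liminf (at_right 0) (\<lambda>t. ereal (\<phi> t))"
      by (simp add: \<psi>_def)
  qed (rule Liminf_le_Liminf_compose[OF filterlim_powr_at_right_0[OF \<open>c > 0\<close>]])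
  show "limsup (\<lambda>N. ereal (\<phi> (real N powr - c))) = Limsup (at_right 0) (\<lambda>t. ereal (\<phi> t))"
  proof (rule antisym)
    have "Limsup (at_right 0) (\<lambda>t. ereal (\<phi> t)) \<le> Limsup (at_right 0) (\<lambda>t. ereal (\<psi> (n t)))"
      using Limsup_ereal_mono_eps[OF nb up_eps] .
    also have "\<dots> \<le> limsup (\<lambda>N. ereal (\<psi> N))"
      using Limsup_compose_le_Limsup[OF n_lim] .
    finally show "Limsup (at_right 0) (\<lambda>t. ereal (\<phi> t)) \<le> limsup (\<lambda>N. ereal (\<phi> (real N powr - c)))"
      by (simp add: \<psi>_def)
  qed (rule Limsup_compose_le_Limsup[OF filterlim_powr_at_right_0[OF \<open>c > 0\<close>]])
qed

text \<open>Because \<open>log 2 (1 / t) / L t\<close> is bounded by \<open>d\<close>, replacing an exponent \<open>s\<close> close to \<open>1\<close> by \<open>1\<close>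
  costs only a small additive error.\<close>

lemma liminf_limsup_log_quotient:
  fixes L g :: "_ \<Rightarrow> real" and E :: "nat \<Rightarrow> real"
  assumes "d > 0"
    and lower: "\<And>t. 0 < t \<Longrightarrow> t < 1 \<Longrightarrow> log 2 (1 / t) \<le> d * L t"
    and mono: "\<And>s t. 0 < s \<Longrightarrow> s \<le> t \<Longrightarrow> t < 1 \<Longrightarrow> L t \<le> L s"
    and up: "\<And>s. 0 < s \<Longrightarrow> s < 1 \<Longrightarrow> eventually (\<lambda>N. L (real N powr - s) \<le> E N) sequentially"
    and low: "\<And>s. 1 < s \<Longrightarrow> eventually (\<lambda>N. E N \<le> L (real N powr - s) + 1) sequentially"
  shows "liminf (\<lambda>N. ereal (log 2 (real N) / E N)) = Liminf (at_right 0) (\<lambda>t. ereal (log 2 (1 / t) / L t))"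
    and "limsup (\<lambda>N. ereal (log 2 (real N) / E N)) = Limsup (at_right 0) (\<lambda>t. ereal (log 2 (1 / t) / L t))"
proof -
  define \<phi> where "\<phi> = (\<lambda>t. log 2 (1 / t) / L t)"
  define g where "g = (\<lambda>N. log 2 (real N) / E N)"
  have pow01: "0 < real N powr - s" "real N powr - s < 1" if "N \<ge> 2" "s > 0" for N s
    using that powr_less_one[of "real N" "- s"] by auto
  have logpow: "log 2 (1 / (real N powr - c)) = c * log 2 (real N)" if "N \<ge> 2" for N c
    using that by (simp add: powr_minus log_powr inverse_eq_divide)
  have Lbig: "s * log 2 (real N) \<le> d * L (real N powr - s)" if "N \<ge> 2" "s > 0" for N s
    using lower[OF pow01[OF that]] logpow[OF that(1), of s] by simp
  have Lpos: "L (real N powr - s) > 0" if "N \<ge> 2" "s > 0" for N s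
  proof -
    have "0 < s * log 2 (real N)" using that by simp
    then have "0 < d * L (real N powr - s)" using Lbig[OF that] by linarith
    then show ?thesis using \<open>d > 0\<close> by (simp add: zero_less_mult_iff)
  qed
  \<comment> \<open>Any exponent below \<open>1\<close> would do: the aim is that \<open>E\<close>
    is eventually positive, so that quotients by \<open>E\<close> can be compared.\<close>
  have "eventually (\<lambda>N. L (real N powr - (1 / 2)) \<le> E N) sequentially" by (rule up) auto
  then have Epos: "eventually (\<lambda>N. E N > 0) sequentially"
    using eventually_ge_at_top[of "2::nat"]
  proof eventually_elim
    case (elim N)
    then show ?case using Lpos[of N "1 / 2"] by simp
  qed
  have g_le: "\<exists>s>0. eventually (\<lambda>N. g N \<le> \<phi> (real N powr - s) + e) sequentially" if "e > 0" for e
  proof -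
    \<comment> \<open>Solves \<open>d * (1 / s - 1) = e\<close>: the relative error
      \<open>1 / s - 1\<close> times the bound \<open>d\<close> of the ratio is the permitted
      additive error.\<close>
    define s where "s = d / (d + e)"
    have s: "0 < s" "s < 1" "d * (1 / s - 1) = e"
      using \<open>e > 0\<close> \<open>d > 0\<close> by (auto simp: s_def field_simps)
    have "eventually (\<lambda>N. g N \<le> \<phi> (real N powr - s) + e) sequentially"
      using up[OF s(1,2)] eventually_ge_at_top[of "2::nat"]
    proof eventually_elim
      case (elim N)
      let ?L = "L (real N powr - s)"
      have "g N \<le> log 2 (real N) / ?L"
        unfolding g_def using elim Lpos[OF elim(2) s(1)] by (intro divide_left_mono) auto
      moreover have \<phi>: "\<phi> (real N powr - s) = s * (log 2 (real N) / ?L)"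
        using logpow[OF elim(2), of s] by (simp add: \<phi>_def)
      moreover have \<phi>_le: "\<phi> (real N powr - s) \<le> d"
        using Lbig[OF elim(2) s(1)] Lpos[OF elim(2) s(1)] logpow[OF elim(2), of s]
        by (simp add: \<phi>_def field_simps)
      moreover have "log 2 (real N) / ?L = \<phi> (real N powr - s) + \<phi> (real N powr - s) * (1 / s - 1)"
      proof -
        have "x = s * x + s * x * (1 / s - 1)" for x :: real using s(1) by (simp add: right_diff_distrib)
        then show ?thesis unfolding \<phi> .
      qed
      moreover have "\<phi> (real N powr - s) * (1 / s - 1) \<le> d * (1 / s - 1)"
        using \<phi>_le s(1,2) by (intro mult_right_mono) simp_all
      ultimately show ?case using s(3) by linarith
    qed
    then show ?thesis using s by blast
  qed
  have le_g: "\<exists>s>0. eventually (\<lambda>N. \<phi> (real N powr - s) \<le> g N + e) sequentially" if "e > 0" for e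
  proof -
    \<comment> \<open>Half of \<open>e\<close> pays for the exponent, through
      \<open>d * (s - 1) = e / 2\<close>; the other half is left for the summand \<open>1\<close> in
      \<open>low\<close>.\<close>
    define s where "s = 1 + e / (2 * d)"
    have s: "1 < s" "d * (s - 1) = e / 2"
      using \<open>e > 0\<close> \<open>d > 0\<close> by (auto simp: s_def field_simps)
    \<comment> \<open>Together with \<open>s * log 2 N \<le> d * L\<close> this makes
      \<open>L\<close> so large that \<open>d / L \<le> e / 2\<close>.\<close>
    have "eventually (\<lambda>N. d * d / (e / 2) \<le> s * log 2 (real N)) sequentially"
      using s by real_asymp
    then have "eventually (\<lambda>N. \<phi> (real N powr - s) \<le> g N + e) sequentially"
      using low[OF s(1)] Epos eventually_ge_at_top[of "2::nat"]
    proof eventually_elim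
      case (elim N)
      let ?L = "L (real N powr - s)" and ?l = "log 2 (real N)"
      have Lp: "?L > 0" using Lpos elim(4) s by auto
      have lp: "?l > 0" using elim(4) by simp
      have "?l / (?L + 1) \<le> g N"
        unfolding g_def using elim Lp lp by (intro divide_left_mono) auto
      moreover have \<phi>: "\<phi> (real N powr - s) = s * ?l / ?L"
        using logpow[OF elim(4), of s] by (simp add: \<phi>_def)
      moreover have b: "s * ?l / ?L \<le> d"
        using Lbig[OF elim(4), of s] Lp s by (simp add: field_simps)
      moreover have "s * ?l / ?L - ?l / (?L + 1) \<le> e"
      proof -
        \<comment> \<open>The first term is the cost of the exponent \<open>s\<close>, the second
          the cost of replacing \<open>L\<close> by \<open>L + 1\<close>.\<close>
        have "s * ?l / ?L - ?l / (?L + 1) = (s - 1) * (?l / ?L) + (?l / ?L) / (?L + 1)"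
        proof -
          have "?l / (?L + 1) = ?l / ?L * (?L / (?L + 1))" using Lp by simp
          also have "?L / (?L + 1) = 1 - 1 / (?L + 1)" using Lp by (simp add: divide_simps)
          finally have eq: "?l / (?L + 1) = ?l / ?L * (1 - 1 / (?L + 1))" .
          have "s * y - y * (1 - z) = (s - 1) * y + y * z" for y z :: real by (simp add: algebra_simps)
          from this[of "?l / ?L" "1 / (?L + 1)"] show ?thesis unfolding eq by simp
        qed
        moreover have ll: "?l / ?L \<le> d"
          using b s lp Lp mult_right_mono[of 1 s "?l / ?L"] by simp
        then have "(s - 1) * (?l / ?L) \<le> (s - 1) * d" using s by (intro mult_left_mono) auto
        moreover have "(?l / ?L) / (?L + 1) \<le> d / ?L"
          using ll lp Lp \<open>d > 0\<close> by (intro frac_le) auto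
        moreover have "d / ?L \<le> e / 2"
        proof -
          have "d * d \<le> d * ?L * (e / 2)"
            using order_trans[OF elim(1) Lbig[OF elim(4)]] s \<open>e > 0\<close> by (simp add: field_simps)
          then show ?thesis using \<open>d > 0\<close> Lp by (simp add: field_simps)
        qed
        moreover have "(s - 1) * d = e / 2" using s(2) by (simp only: mult.commute)
        ultimately show ?thesis by linarith
      qed
      ultimately show ?case by linarith
    qed
    then show ?thesis using s by (intro exI[of _ s]) auto
  qed
  \<comment> \<open>The limits along \<open>N powr - c\<close> do not depend on \<open>c\<close>, so
    the exponent \<open>s\<close>, which varies with \<open>e\<close>, disappears.\<close>
  have eq: "liminf (\<lambda>N. ereal (\<phi> (real N powr - c))) = Liminf (at_right 0) (\<lambda>t. ereal (\<phi> t))"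
    "limsup (\<lambda>N. ereal (\<phi> (real N powr - c))) = Limsup (at_right 0) (\<lambda>t. ereal (\<phi> t))"
    if "c > 0" for c
    unfolding \<phi>_def using Liminf_Limsup_log_ratio_powr[OF that \<open>d > 0\<close> mono lower] by blast+
  show "liminf (\<lambda>N. ereal (log 2 (real N) / E N)) = Liminf (at_right 0) (\<lambda>t. ereal (log 2 (1 / t) / L t))"
    unfolding g_def[symmetric, THEN fun_cong] \<phi>_def[symmetric, THEN fun_cong]
  proof (rule antisym; rule ereal_le_epsilon2)
    fix e :: real assume "e > 0"
    obtain s where s: "s > 0" "eventually (\<lambda>N. g N \<le> \<phi> (real N powr - s) + e) sequentially"
      using g_le[OF \<open>e > 0\<close>] by blast
    then have "liminf (\<lambda>N. ereal (g N)) \<le> liminf (\<lambda>N. ereal (\<phi> (real N powr - s)) + ereal e)"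
      by (intro Liminf_mono) simp
    also have "\<dots> = liminf (\<lambda>N. ereal (\<phi> (real N powr - s))) + ereal e"
      by (intro Liminf_add_ereal_right) auto
    finally show "liminf (\<lambda>N. ereal (g N)) \<le> Liminf (at_right 0) (\<lambda>t. ereal (\<phi> t)) + ereal e"
      using eq(1)[OF s(1)] by simp
    obtain s where s: "s > 0" "eventually (\<lambda>N. \<phi> (real N powr - s) \<le> g N + e) sequentially"
      using le_g[OF \<open>e > 0\<close>] by blast
    then have "liminf (\<lambda>N. ereal (\<phi> (real N powr - s))) \<le> liminf (\<lambda>N. ereal (g N) + ereal e)"
      by (intro Liminf_mono) simp
    also have "\<dots> = liminf (\<lambda>N. ereal (g N)) + ereal e"
      by (intro Liminf_add_ereal_right) auto
    finally show "Liminf (at_right 0) (\<lambda>t. ereal (\<phi> t)) \<le> liminf (\<lambda>N. ereal (g N)) + ereal e"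
      using eq(1)[OF s(1)] by simp
  qed
  show "limsup (\<lambda>N. ereal (log 2 (real N) / E N)) = Limsup (at_right 0) (\<lambda>t. ereal (log 2 (1 / t) / L t))"
    unfolding g_def[symmetric, THEN fun_cong] \<phi>_def[symmetric, THEN fun_cong]
  proof (rule antisym; rule ereal_le_epsilon2)
    fix e :: real assume "e > 0"
    obtain s where s: "s > 0" "eventually (\<lambda>N. g N \<le> \<phi> (real N powr - s) + e) sequentially"
      using g_le[OF \<open>e > 0\<close>] by blast
    then have "limsup (\<lambda>N. ereal (g N)) \<le> limsup (\<lambda>N. ereal (\<phi> (real N powr - s)) + ereal e)"
      by (intro Limsup_mono) simp
    also have "\<dots> = limsup (\<lambda>N. ereal (\<phi> (real N powr - s))) + ereal e"
      by (intro Limsup_add_ereal_right) auto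
    finally show "limsup (\<lambda>N. ereal (g N)) \<le> Limsup (at_right 0) (\<lambda>t. ereal (\<phi> t)) + ereal e"
      using eq(2)[OF s(1)] by simp
    obtain s where s: "s > 0" "eventually (\<lambda>N. \<phi> (real N powr - s) \<le> g N + e) sequentially"
      using le_g[OF \<open>e > 0\<close>] by blast
    then have "limsup (\<lambda>N. ereal (\<phi> (real N powr - s))) \<le> limsup (\<lambda>N. ereal (g N) + ereal e)"
      by (intro Limsup_mono) simp
    also have "\<dots> = limsup (\<lambda>N. ereal (g N)) + ereal e"
      by (intro Limsup_add_ereal_right) auto
    finally show "Limsup (at_right 0) (\<lambda>t. ereal (\<phi> t)) \<le> limsup (\<lambda>N. ereal (g N)) + ereal e"
      using eq(2)[OF s(1)] by simp
  qed
qed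

section \<open>The threshold partition\<close>

text \<open>Follows from \<open>ln x \<le> x - 1\<close> at \<open>x = q i / p i\<close>. The
  weights \<open>q\<close> may have total mass below \<open>1\<close>, as do the volumes of
  partition cubes that fail to fill the root cube.\<close>

lemma gibbs_inequality:
  fixes p q :: "'a \<Rightarrow> real"
  assumes "1 < b" and p: "\<And>i. i \<in> S \<Longrightarrow> 0 < p i" and q: "\<And>i. i \<in> S \<Longrightarrow> 0 < q i"
    and "sum p S = 1" "sum q S \<le> 1"
  shows "- (\<Sum>i\<in>S. p i * log b (p i)) \<le> - (\<Sum>i\<in>S. p i * log b (q i))"
proof -
  have "p i * ln (q i) - p i * ln (p i) \<le> q i - p i" if "i \<in> S" for i
  proof -
    have "p i * ln (q i / p i) \<le> p i * (q i / p i - 1)"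
      using p[OF that] q[OF that] by (intro mult_left_mono ln_le_minus_one) auto
    then show ?thesis using p[OF that] q[OF that] by (simp add: ln_div algebra_simps)
  qed
  then have "(\<Sum>i\<in>S. p i * ln (q i) - p i * ln (p i)) \<le> (\<Sum>i\<in>S. q i - p i)"
    by (rule sum_mono)
  also have "\<dots> \<le> 0" using assms by (simp add: sum_subtractf)
  finally have "(\<Sum>i\<in>S. p i * ln (q i)) \<le> (\<Sum>i\<in>S. p i * ln (p i))"
    by (simp add: sum_subtractf)
  then have "(\<Sum>i\<in>S. p i * ln (q i)) / ln b \<le> (\<Sum>i\<in>S. p i * ln (p i)) / ln b"
    using \<open>1 < b\<close> by (intro divide_right_mono) auto
  then show ?thesis by (simp add: log_def sum_divide_distrib)
qed

text \<open>The complement of the support is a union of open null sets; by second countability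
  countably many of them suffice.\<close>

lemma AE_in_msupport:
  fixes \<nu> :: "'a::second_countable_topology measure"
  assumes "sets \<nu> = sets borel"
  shows "AE x in \<nu>. x \<in> msupport \<nu>"
proof -
  define F where "F = {U. open U \<and> emeasure \<nu> U = 0}"
  obtain F' where F': "F' \<subseteq> F" "countable F'" "\<Union>F' = \<Union>F"
    using Lindelof[of F] by (auto simp: F_def)
  have "(\<Union>U\<in>F'. U) \<in> null_sets \<nu>"
    using F' assms by (intro null_sets_UN') (auto simp: F_def null_sets_def)
  moreover have "- msupport \<nu> \<subseteq> \<Union>F'"
    unfolding F'(3) F_def msupport_def by (auto simp: not_gr_zero)
  ultimately show ?thesis
    by (intro AE_I'[of "\<Union>F'"]) auto
qed

text \<open>Decay is assumed for the cubes around points of the root cube, and the support condition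
  is recorded as an almost-everywhere statement: these are the forms in which the estimates use
  them.\<close>

locale dyadic_decay = prob_space \<nu> for \<nu> :: "(real ^ 'n) measure" +
  fixes a C :: real
  assumes sets_borel [measurable_cong, simp]: "sets \<nu> = sets borel"
    and AE_root: "AE x in \<nu>. x \<in> root_cube"
    and a_pos: "a > 0" and C_ge_1: "C \<ge> 1"
    and decay: "\<And>k x. x \<in> root_cube \<Longrightarrow> prob (cube_at k x) \<le> C * 2 powr (- a * real k)"
begin

lemma space_UNIV [simp]: "space \<nu> = UNIV"
  using sets_eq_imp_space_eq[OF sets_borel] by simp

lemma prob_root: "prob root_cube = 1"
proof -
  have "(0 :: real ^ 'n) \<in> root_cube" by (simp add: root_cube_def)
  then have "(root_cube :: (real ^ 'n) set) \<in> sets borel" using cube_at_borel cube_at_0 by metis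
  then show ?thesis using prob_eq_1[of root_cube] AE_root by simp
qed

lemma decay_tendsto_0: "(\<lambda>k. C * 2 powr (- a * real k)) \<longlonglongrightarrow> 0"
  using a_pos by real_asymp

section \<open>Stopping levels and stopped cubes\<close>

lemma prob_cube_at_less:
  assumes "x \<in> root_cube" "0 < t" shows "\<exists>k. prob (cube_at k x) < t"
proof -
  obtain k where "C * 2 powr (- a * real k) < t"
    using eventually_happens[OF order_tendstoD(2)[OF decay_tendsto_0 assms(2)]] by auto
  then show ?thesis using decay[OF assms(1)] le_less_trans by blast
qed

lemma prob_cube_at_antimono:
  assumes "x \<in> root_cube" "k \<le> m" shows "prob (cube_at m x) \<le> prob (cube_at k x)"
  using assms cube_at_antimono by (intro finite_measure_mono) auto

text \<open>The \<open>\<kappa>\<^sub>t(x)\<close> of the overview; for \<open>x\<close> in the root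
  cube and \<open>t > 0\<close> the least generation exists by decay.\<close>

definition stop_level :: "real \<Rightarrow> real ^ 'n \<Rightarrow> nat" where
  "stop_level t x = (LEAST k. prob (cube_at k x) < t)"

text \<open>Mass decreases along nested cubes, so once the cube around \<open>x\<close> is lighter
  than \<open>t\<close> it stays so.\<close>

lemma stop_level_le_iff:
  assumes "x \<in> root_cube" "0 < t"
  shows "stop_level t x \<le> m \<longleftrightarrow> prob (cube_at m x) < t"
proof
  have "prob (cube_at (stop_level t x) x) < t"
    unfolding stop_level_def using prob_cube_at_less[OF assms] by (rule LeastI_ex)
  moreover assume "stop_level t x \<le> m"
  ultimately show "prob (cube_at m x) < t"
    using prob_cube_at_antimono[OF assms(1)] le_less_trans by blast
next
  assume "prob (cube_at m x) < t"
  then show "stop_level t x \<le> m" unfolding stop_level_def by (rule Least_le)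
qed

text \<open>The root cube has mass \<open>1\<close> and is never lighter than \<open>t\<close>;
  hence every stopped cube has a parent.\<close>

lemma stop_level_pos:
  assumes "x \<in> root_cube" "0 < t" "t < 1" shows "0 < stop_level t x"
  using stop_level_le_iff[OF assms(1,2), of 0] cube_at_0[OF assms(1)] prob_root assms(3) by simp

lemma stop_level_antimono:
  assumes "x \<in> root_cube" "0 < s" "s \<le> t" shows "stop_level t x \<le> stop_level s x"
  using assms stop_level_le_iff[of x t] stop_level_le_iff[of x s "stop_level s x"] by simp

text \<open>Points of one stopped cube share all its ancestors, hence see the same masses up to the
  stopping generation.\<close>

lemma stop_level_cong:
  assumes "x \<in> root_cube" "0 < t" "y \<in> cube_at (stop_level t x) x"
  shows "stop_level t y = stop_level t x"
proof (rule antisym)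
  have y: "y \<in> root_cube" using assms(3) cube_at_subset_root by blast
  show *: "stop_level t y \<le> stop_level t x"
    using stop_level_le_iff[OF y assms(2)] stop_level_le_iff[OF assms(1,2)] cube_at_eq[OF assms(3)] by auto
  have "y \<in> cube_at (stop_level t y) x" using cube_at_antimono[OF assms(1) *] assms(3) by blast
  then have "cube_at (stop_level t y) y = cube_at (stop_level t y) x" by (rule cube_at_eq)
  then show "stop_level t x \<le> stop_level t y"
    using stop_level_le_iff[OF y assms(2), of "stop_level t y"] stop_level_le_iff[OF assms(1,2)] by simp
qed

definition stop_cube :: "real \<Rightarrow> real ^ 'n \<Rightarrow> (real ^ 'n) set" where
  "stop_cube t x = cube_at (stop_level t x) x"

text \<open>A light cube with a heavy parent is one at whose generation stopping occurs. Positive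
  mass remains a separate condition, since null cubes can be stopped cubes too.\<close>

lemma thr_partition_eq:
  assumes "0 < t" "t < 1"
  shows "thr_partition \<nu> t = {Q \<in> stop_cube t ` root_cube. 0 < prob Q}"
proof (intro antisym subsetI)
  fix Q assume "Q \<in> thr_partition \<nu> t"
  then have Q: "Q \<in> all_dyadic_cubes" "Q \<notin> dyadic_cubes 0" "0 < prob Q" "prob Q < t" "t \<le> prob (dyadic_parent Q)"
    by (auto simp: thr_partition_def)
  then obtain k x where x: "x \<in> root_cube" "Q = cube_at k x"
    by (auto simp: all_dyadic_cubes_def dyadic_cubes_eq)
  then obtain j where k: "k = Suc j" using Q(2) by (cases k) (auto simp: dyadic_cubes_eq)
  have "stop_level t x = Suc j"
    using Q x k dyadic_parent_cube_at[OF x(1)] stop_level_le_iff[OF x(1) assms(1), of j]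
      stop_level_le_iff[OF x(1) assms(1), of "Suc j"] by simp
  then have "Q = stop_cube t x" using x k by (simp add: stop_cube_def)
  then show "Q \<in> {Q \<in> stop_cube t ` root_cube. 0 < prob Q}" using Q(3) x(1) by blast
next
  fix Q assume "Q \<in> {Q \<in> stop_cube t ` root_cube. 0 < prob Q}"
  then obtain x where x: "x \<in> root_cube" "Q = stop_cube t x" "0 < prob Q" by blast
  obtain j where j: "stop_level t x = Suc j" using stop_level_pos[OF x(1) assms] by (cases "stop_level t x") auto
  have "Q \<notin> dyadic_cubes 0"
  proof
    assume "Q \<in> dyadic_cubes 0"
    then obtain y where "y \<in> root_cube" "Q = cube_at 0 y" by (auto simp: dyadic_cubes_eq)
    then show False using cube_level_cube_at[OF x(1), of "Suc j"] cube_level_cube_at[of y 0] x j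
      by (simp add: stop_cube_def)
  qed
  moreover have Q: "Q = cube_at (Suc j) x" using x(2) j by (simp add: stop_cube_def)
  then have "Q \<in> all_dyadic_cubes" using x(1) unfolding all_dyadic_cubes_def dyadic_cubes_eq by blast
  moreover have "prob Q < t" "t \<le> prob (dyadic_parent Q)"
    using j stop_level_le_iff[OF x(1) assms(1), of j] stop_level_le_iff[OF x(1) assms(1), of "Suc j"]
    by (simp_all add: Q dyadic_parent_cube_at[OF x(1)])
  ultimately show "Q \<in> thr_partition \<nu> t" using x(3) by (simp add: thr_partition_def)
qed

lemma thr_partition_cases:
  assumes "0 < t" "t < 1" "Q \<in> thr_partition \<nu> t"
  obtains x where "x \<in> root_cube" "Q = stop_cube t x" "0 < prob Q"
  using assms thr_partition_eq by auto

lemma stop_cube_eq: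
  assumes "0 < t" "x \<in> root_cube" "y \<in> stop_cube t x" shows "stop_cube t y = stop_cube t x"
  using assms stop_level_cong[of x t y] cube_at_eq by (simp add: stop_cube_def)

lemma stop_cube_self: "x \<in> root_cube \<Longrightarrow> x \<in> stop_cube t x"
  by (simp add: stop_cube_def cube_at_self)

lemma thr_partition_member:
  assumes "0 < t" "t < 1" "Q \<in> thr_partition \<nu> t" "x \<in> Q"
  shows "Q = stop_cube t x"
  using assms stop_cube_eq thr_partition_cases by metis

lemma disjoint_family_thr_partition:
  assumes "0 < t" "t < 1" shows "disjoint_family_on (\<lambda>Q. Q) (thr_partition \<nu> t)"
  unfolding disjoint_family_on_def
proof (intro ballI impI equals0I)
  fix P Q x assume "P \<in> thr_partition \<nu> t" "Q \<in> thr_partition \<nu> t" "P \<noteq> Q" "x \<in> P \<inter> Q"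
  then show False using thr_partition_member[OF assms, of P x] thr_partition_member[OF assms, of Q x] by simp
qed

lemma thr_partition_borel:
  assumes "0 < t" "t < 1" "Q \<in> thr_partition \<nu> t" shows "Q \<in> sets borel"
  using thr_partition_cases[OF assms] by (metis cube_at_borel stop_cube_def)

text \<open>Each generation has finitely many cubes, so its null cubes together form a null set, and
  there are countably many generations.\<close>

lemma AE_prob_cube_pos: "AE x in \<nu>. x \<in> root_cube \<and> (\<forall>k. 0 < prob (cube_at k x))"
proof -
  have "AE x in \<nu>. x \<in> root_cube \<longrightarrow> 0 < prob (cube_at k x)" for k
  proof (rule AE_I')
    show "(\<Union>Q\<in>{Q \<in> dyadic_cubes k. prob Q = 0}. Q) \<in> null_sets \<nu>"
    proof (rule null_sets_UN')
      show "countable {Q \<in> dyadic_cubes k. prob Q = 0}" by (rule countable_finite) simp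
      fix Q assume Q: "Q \<in> {Q \<in> dyadic_cubes k. prob Q = 0}"
      then have "Q \<in> sets borel" using cube_at_borel unfolding dyadic_cubes_eq by blast
      then show "Q \<in> null_sets \<nu>" using Q by (simp add: null_sets_def emeasure_eq_measure)
    qed
    show "{x \<in> space \<nu>. \<not> (x \<in> root_cube \<longrightarrow> 0 < prob (cube_at k x))}
        \<subseteq> (\<Union>Q\<in>{Q \<in> dyadic_cubes k. prob Q = 0}. Q)"
    proof
      fix x assume "x \<in> {x \<in> space \<nu>. \<not> (x \<in> root_cube \<longrightarrow> 0 < prob (cube_at k x))}"
      then have x: "x \<in> root_cube" "prob (cube_at k x) = 0" by (auto simp: zero_less_measure_iff)
      then have "cube_at k x \<in> {Q \<in> dyadic_cubes k. prob Q = 0}" by (simp add: dyadic_cubes_eq)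
      then show "x \<in> (\<Union>Q\<in>{Q \<in> dyadic_cubes k. prob Q = 0}. Q)" using cube_at_self[OF x(1)] by blast
    qed
  qed
  then have "AE x in \<nu>. \<forall>k. x \<in> root_cube \<longrightarrow> 0 < prob (cube_at k x)"
    by (subst AE_all_countable) blast
  with AE_root show ?thesis by eventually_elim auto
qed

lemma AE_stop_cube_mem:
  assumes "0 < t" "t < 1"
  shows "AE x in \<nu>. x \<in> root_cube \<and> stop_cube t x \<in> thr_partition \<nu> t"
  using AE_prob_cube_pos
  by eventually_elim (simp add: thr_partition_eq[OF assms] stop_cube_def)

text \<open>The cubes of one generation are disjoint, each heavy one has mass at least
  \<open>t\<close>, and the total mass is at most \<open>1\<close>.\<close>

lemma card_heavy_cubes_le:
  assumes "0 < t" shows "real (card {Q \<in> dyadic_cubes k. t \<le> prob Q}) \<le> 1 / t"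
proof -
  let ?S = "{Q \<in> dyadic_cubes k. t \<le> prob Q}"
  have fin: "finite ?S" by simp
  have "disjoint_family_on (\<lambda>Q. Q) ?S"
    unfolding disjoint_family_on_def
  proof (intro ballI impI equals0I)
    fix P Q x assume "P \<in> ?S" "Q \<in> ?S" "P \<noteq> Q" "x \<in> P \<inter> Q"
    moreover have "P = cube_at k x" if "P \<in> ?S" "x \<in> P" for P x
      using that cube_at_eq unfolding dyadic_cubes_eq by blast
    ultimately show False by blast
  qed
  then have "prob (\<Union>Q\<in>?S. Q) = (\<Sum>Q\<in>?S. prob Q)"
    using fin cube_at_borel by (intro finite_measure_finite_Union) (auto simp: dyadic_cubes_eq)
  moreover have "real (card ?S) * t \<le> (\<Sum>Q\<in>?S. prob Q)"
    using sum_bounded_below[of ?S t prob] by simp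
  ultimately have "real (card ?S) * t \<le> 1" using prob_le_1[of "\<Union>Q\<in>?S. Q"] by linarith
  then show ?thesis using assms by (simp add: field_simps)
qed

text \<open>Every partition cube is a child of a heavy cube. A generation has at most
  \<open>1 / t\<close> heavy cubes, each with at most \<open>2 ^ d\<close> children, where
  \<open>d\<close> is the dimension; decay limits the number of generations, which yields the
  logarithmic factor.\<close>

lemma finite_thr_partition_card_le:
  assumes t: "0 < t" "t < 1"
  shows "finite (thr_partition \<nu> t)"
    and "real (thr_card \<nu> t) \<le> 2 ^ CARD('n) * max (1 + log 2 C / a) (1 / a) * (1 / t) * (1 + log 2 (1 / t))"
proof -
  \<comment> \<open>The last generation in which decay still permits mass \<open>t\<close>, from
    solving \<open>t \<le> C * 2 powr (- a * k)\<close> for \<open>k\<close>.\<close>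
  define K where "K = nat \<lfloor>log 2 (C / t) / a\<rfloor>"
  define H where "H = (\<lambda>k. {Q \<in> dyadic_cubes k. t \<le> prob Q})"
  define Ch where "Ch = (\<lambda>k Q'. {cube_at (Suc k) y |y. y \<in> Q'} :: (real ^ 'n) set set)"
  have logC: "0 \<le> log 2 C" "0 < log 2 (1 / t)" "log 2 (C / t) = log 2 C + log 2 (1 / t)"
    using C_ge_1 t by (auto simp: log_divide)
  have finH: "finite (H k)" for k unfolding H_def by simp
  have Ch_sub: "Ch k Q' \<subseteq> dyadic_cubes (Suc k)" if Q': "Q' \<in> H k" for k Q'
  proof
    fix R assume "R \<in> Ch k Q'"
    then obtain y where y: "y \<in> Q'" "R = cube_at (Suc k) y" unfolding Ch_def by blast
    obtain x where "Q' = cube_at k x" using Q' unfolding H_def dyadic_cubes_eq by blast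
    then have "y \<in> root_cube" using y(1) cube_at_subset_root[of k x] by blast
    then show "R \<in> dyadic_cubes (Suc k)" using y(2) by (simp add: dyadic_cubes_eq)
  qed
  then have finCh: "finite (Ch k Q')" if "Q' \<in> H k" for k Q'
    using that finite_dyadic_cubes finite_subset by blast
  have sub: "thr_partition \<nu> t \<subseteq> (\<Union>k\<in>{..K}. \<Union>Q'\<in>H k. Ch k Q')"
  proof
    fix Q assume "Q \<in> thr_partition \<nu> t"
    then obtain x where x: "x \<in> root_cube" "Q = stop_cube t x" using thr_partition_cases[OF t] by metis
    obtain j where j: "stop_level t x = Suc j" using stop_level_pos[OF x(1) t] by (cases "stop_level t x") auto
    have heavy: "t \<le> prob (cube_at j x)" using j stop_level_le_iff[OF x(1) t(1), of j] by simp
    then have "t \<le> C * 2 powr (- a * real j)" using decay[OF x(1)] order_trans by blast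
    then have "log 2 t \<le> log 2 (C * 2 powr (- a * real j))" using t by simp
    also have "\<dots> = log 2 C - a * real j" using C_ge_1 by (simp add: log_mult)
    finally have "real j \<le> log 2 (C / t) / a" using a_pos t C_ge_1 by (simp add: log_divide field_simps)
    then have "j \<le> K" unfolding K_def by (simp add: le_nat_floor)
    moreover have "cube_at j x \<in> H j" using heavy x by (auto simp: H_def dyadic_cubes_eq)
    moreover have "Q \<in> Ch j (cube_at j x)"
      unfolding Ch_def using x j cube_at_self by (auto simp: stop_cube_def)
    ultimately show "Q \<in> (\<Union>k\<in>{..K}. \<Union>Q'\<in>H k. Ch k Q')" by blast
  qed
  show fin: "finite (thr_partition \<nu> t)"
    using finH finCh by (intro finite_subset[OF sub]) auto
  have "card (Ch k Q') \<le> 2 ^ CARD('n)" if "Q' \<in> H k" for k Q'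
    using that card_children_le unfolding Ch_def H_def dyadic_cubes_eq by auto
  then have Ch_card: "(\<Sum>Q'\<in>H k. card (Ch k Q')) \<le> card (H k) * 2 ^ CARD('n)" for k
    using sum_bounded_above[of "H k" "\<lambda>Q'. card (Ch k Q')" "2 ^ CARD('n)"] by simp
  have "card (\<Union>k\<in>{..K}. \<Union>Q'\<in>H k. Ch k Q') \<le> (\<Sum>k\<in>{..K}. card (\<Union>Q'\<in>H k. Ch k Q'))"
    by (rule card_UN_le) simp
  also have "\<dots> \<le> (\<Sum>k\<in>{..K}. card (H k) * 2 ^ CARD('n))"
    by (rule sum_mono) (rule order_trans[OF card_UN_le[OF finH] Ch_card])
  finally have "card (\<Union>k\<in>{..K}. \<Union>Q'\<in>H k. Ch k Q') \<le> (\<Sum>k\<in>{..K}. card (H k) * 2 ^ CARD('n))" .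
  moreover have "thr_card \<nu> t \<le> card (\<Union>k\<in>{..K}. \<Union>Q'\<in>H k. Ch k Q')"
    unfolding thr_card_def using finH finCh by (intro card_mono[OF _ sub]) auto
  ultimately have "thr_card \<nu> t \<le> (\<Sum>k\<in>{..K}. card (H k) * 2 ^ CARD('n))" by linarith
  then have "real (thr_card \<nu> t) \<le> real (\<Sum>k\<in>{..K}. card (H k) * 2 ^ CARD('n))"
    by (rule of_nat_mono)
  also have "\<dots> = (\<Sum>k\<in>{..K}. real (card (H k)) * 2 ^ CARD('n))" by simp
  also have "\<dots> \<le> (\<Sum>k\<in>{..K}. (1 / t) * 2 ^ CARD('n))"
    using card_heavy_cubes_le[OF t(1)] by (intro sum_mono mult_right_mono) (auto simp: H_def)
  also have "\<dots> = 2 ^ CARD('n) * (1 / t) * (1 + real K)" by (simp add: algebra_simps add_divide_distrib)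
  also have "\<dots> \<le> 2 ^ CARD('n) * (1 / t) * (max (1 + log 2 C / a) (1 / a) * (1 + log 2 (1 / t)))"
  proof (intro mult_left_mono)
    have "0 \<le> log 2 (C / t) / a" using logC a_pos by simp
    then have "real K \<le> log 2 (C / t) / a" unfolding K_def by (simp add: of_nat_nat)
    then have "1 + real K \<le> (1 + log 2 C / a) + (1 / a) * log 2 (1 / t)"
      using logC by (simp add: add_divide_distrib)
    also have "\<dots> \<le> max (1 + log 2 C / a) (1 / a) + max (1 + log 2 C / a) (1 / a) * log 2 (1 / t)"
      using logC by (intro add_mono mult_right_mono) auto
    finally show "1 + real K \<le> max (1 + log 2 C / a) (1 / a) * (1 + log 2 (1 / t))"
      by (simp add: algebra_simps)
  qed (use t in auto)
  finally show "real (thr_card \<nu> t) \<le> 2 ^ CARD('n) * max (1 + log 2 C / a) (1 / a) * (1 / t) * (1 + log 2 (1 / t))"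
    by (simp add: mult_ac)
qed

section \<open>Sums over the partition as integrals\<close>

lemma sum_indicator_thr_partition:
  fixes f :: "_ \<Rightarrow> real"
  assumes "0 < t" "t < 1" "x \<in> root_cube" "stop_cube t x \<in> thr_partition \<nu> t"
  shows "(\<Sum>Q\<in>thr_partition \<nu> t. f Q * indicator Q x) = f (stop_cube t x)"
proof -
  have "f Q * indicator Q x = (if Q = stop_cube t x then f (stop_cube t x) else 0)"
    if "Q \<in> thr_partition \<nu> t" for Q
  proof (cases "x \<in> Q")
    case True
    then have Q: "Q = stop_cube t x" by (rule thr_partition_member[OF assms(1,2) that])
    show ?thesis unfolding Q using stop_cube_self[OF assms(3)] by simp
  next
    case False
    then have "Q \<noteq> stop_cube t x" using stop_cube_self[OF assms(3)] by blast
    then show ?thesis using False by simp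
  qed
  then have "(\<Sum>Q\<in>thr_partition \<nu> t. f Q * indicator Q x) =
      (\<Sum>Q\<in>thr_partition \<nu> t. if Q = stop_cube t x then f (stop_cube t x) else 0)"
    by (intro sum.cong) auto
  also have "\<dots> = f (stop_cube t x)"
    using finite_thr_partition_card_le(1)[OF assms(1,2)] assms(4) by simp
  finally show ?thesis .
qed

lemma has_integral_thr_partition:
  fixes f :: "_ \<Rightarrow> real"
  assumes "0 < t" "t < 1"
  shows "has_bochner_integral \<nu> (\<lambda>x. \<Sum>Q\<in>thr_partition \<nu> t. f Q * indicator Q x) (\<Sum>Q\<in>thr_partition \<nu> t. f Q * prob Q)"
proof (rule has_bochner_integral_sum)
  fix Q assume "Q \<in> thr_partition \<nu> t"
  then have "Q \<in> events" using thr_partition_borel[OF assms] by simp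
  then have "has_bochner_integral \<nu> (indicat_real Q) (prob Q)"
    by (intro has_bochner_integral_real_indicator) (simp_all add: emeasure_eq_measure)
  then show "has_bochner_integral \<nu> (\<lambda>x. f Q * indicator Q x) (f Q * prob Q)"
    by (rule has_bochner_integral_mult_right)
qed

text \<open>Almost every point lies in exactly one cube of the partition, so leaving out null cubes
  loses no mass.\<close>

lemma sum_prob_thr_partition:
  assumes "0 < t" "t < 1" shows "(\<Sum>Q\<in>thr_partition \<nu> t. prob Q) = 1"
proof -
  have "has_bochner_integral \<nu> (\<lambda>x. \<Sum>Q\<in>thr_partition \<nu> t. 1 * indicator Q x) (\<Sum>Q\<in>thr_partition \<nu> t. 1 * prob Q)"
    by (rule has_integral_thr_partition[OF assms])
  then have "(\<Sum>Q\<in>thr_partition \<nu> t. prob Q) = (\<integral>x. (\<Sum>Q\<in>thr_partition \<nu> t. 1 * indicator Q x) \<partial>\<nu>)"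
    by (simp add: has_bochner_integral_integral_eq)
  also have "\<dots> = (\<integral>x. 1 \<partial>\<nu>)"
  proof (rule integral_cong_AE)
    show "AE x in \<nu>. (\<Sum>Q\<in>thr_partition \<nu> t. 1 * indicator Q x) = (1::real)"
      using AE_stop_cube_mem[OF assms]
      by eventually_elim (use sum_indicator_thr_partition[OF assms, where f = "\<lambda>_. 1"] in auto)
  qed (use has_integral_thr_partition[OF assms, of "\<lambda>_. 1"] in \<open>auto simp: has_bochner_integral_iff\<close>)
  finally show ?thesis using prob_space by simp
qed

text \<open>A version of \<open>stop_level t\<close> up to a null set; as a finite sum of indicators
  it is visibly measurable and integrable.\<close>

definition level_fun :: "real \<Rightarrow> real ^ 'n \<Rightarrow> real" where
  "level_fun t x = (\<Sum>Q\<in>thr_partition \<nu> t. real (cube_level Q) * indicator Q x)"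

lemma AE_level_fun:
  assumes "0 < t" "t < 1"
  shows "AE x in \<nu>. x \<in> root_cube \<and> stop_cube t x \<in> thr_partition \<nu> t \<and> level_fun t x = real (stop_level t x)"
  using AE_stop_cube_mem[OF assms]
proof eventually_elim
  case (elim x)
  then have "level_fun t x = real (cube_level (stop_cube t x))"
    unfolding level_fun_def
    using sum_indicator_thr_partition[OF assms, where f = "\<lambda>Q. real (cube_level Q)"] by blast
  also have "cube_level (stop_cube t x) = stop_level t x"
    using elim by (simp add: stop_cube_def cube_level_cube_at)
  finally show ?case using elim by simp
qed

lemma thr_lyapunov_eq: "thr_lyapunov \<nu> t = (\<Sum>Q\<in>thr_partition \<nu> t. real (cube_level Q) * prob Q)"
  by (simp add: thr_lyapunov_def side_length_def log_divide log_nat_power mult.commute flip: sum_negf)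

lemma has_integral_level_fun:
  assumes "0 < t" "t < 1"
  shows "has_bochner_integral \<nu> (level_fun t) (thr_lyapunov \<nu> t)"
  unfolding thr_lyapunov_eq level_fun_def[abs_def] by (rule has_integral_thr_partition[OF assms])

text \<open>The two sums run over different partitions, but as integrals of stopping levels they can
  be compared pointwise.\<close>

lemma thr_lyapunov_antimono:
  assumes "0 < s" "s \<le> t" "t < 1" shows "thr_lyapunov \<nu> t \<le> thr_lyapunov \<nu> s"
proof -
  have st: "s < 1" "0 < t" using assms by auto
  have "AE x in \<nu>. level_fun t x \<le> level_fun s x"
    using AE_level_fun[OF st(2) assms(3)] AE_level_fun[OF assms(1) st(1)]
    by eventually_elim (use stop_level_antimono assms in auto)
  then have "(\<integral>x. level_fun t x \<partial>\<nu>) \<le> (\<integral>x. level_fun s x \<partial>\<nu>)"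
    using has_integral_level_fun[OF st(2) assms(3)] has_integral_level_fun[OF assms(1) st(1)]
    by (intro integral_mono_AE) (auto simp: has_bochner_integral_iff)
  then show ?thesis
    using has_integral_level_fun[OF st(2) assms(3)] has_integral_level_fun[OF assms(1) st(1)]
    by (simp add: has_bochner_integral_iff)
qed

text \<open>The summands are the Lebesgue volumes of disjoint subsets of the root cube; they will be
  the weights \<open>q\<close> in Gibbs' inequality.\<close>

lemma sum_side_length_le_1:
  assumes "0 < t" "t < 1" shows "(\<Sum>Q\<in>thr_partition \<nu> t. side_length Q ^ CARD('n)) \<le> 1"
proof -
  let ?P = "thr_partition \<nu> t"
  have fin: "finite ?P" by (rule finite_thr_partition_card_le[OF assms])
  have em: "emeasure lborel Q = ennreal (side_length Q ^ CARD('n))" if "Q \<in> ?P" for Q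
    using thr_partition_cases[OF assms that] emeasure_lborel_cube_at cube_level_cube_at
    by (metis side_length_def stop_cube_def)
  have "ennreal (\<Sum>Q\<in>?P. side_length Q ^ CARD('n)) = (\<Sum>Q\<in>?P. emeasure lborel Q)"
    using em by (subst sum_ennreal[symmetric]) (auto simp: side_length_def)
  also have "\<dots> = emeasure lborel (\<Union>Q\<in>?P. Q)"
    using fin thr_partition_borel[OF assms] disjoint_family_thr_partition[OF assms]
    by (intro sum_emeasure) auto
  \<comment> \<open>The root cube is written as the cube of generation \<open>0\<close>, to which
    the volume formula applies.\<close>
  also have "\<dots> \<le> emeasure lborel (cube_at 0 (0 :: real ^ 'n))"
  proof (rule emeasure_mono)
    have "(0 :: real ^ 'n) \<in> root_cube" by (simp add: root_cube_def)
    then have root: "cube_at 0 (0 :: real ^ 'n) = root_cube" "cube_at 0 (0 :: real ^ 'n) \<in> sets borel"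
      by (rule cube_at_0, rule cube_at_borel)
    then show "cube_at 0 (0 :: real ^ 'n) \<in> sets lborel" by simp
    have "Q \<subseteq> root_cube" if Q: "Q \<in> ?P" for Q
    proof -
      obtain x where "Q = stop_cube t x" using thr_partition_cases[OF assms Q] by blast
      then show ?thesis unfolding stop_cube_def using cube_at_subset_root by simp
    qed
    then show "(\<Union>Q\<in>?P. Q) \<subseteq> cube_at 0 (0 :: real ^ 'n)" unfolding root by blast
  qed
  also have "\<dots> = 1" using emeasure_lborel_cube_at[of "0 :: real ^ 'n" 0] by (simp add: root_cube_def)
  finally show ?thesis by (simp add: ennreal_le_1)
qed

section \<open>Entropy bounds\<close>

lemma thr_partition_prob:
  assumes "Q \<in> thr_partition \<nu> t" shows "0 < prob Q" "prob Q < t"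
  using assms by (auto simp: thr_partition_def)

lemma log_le_thr_entropy:
  assumes "0 < t" "t < 1" shows "log 2 (1 / t) \<le> thr_entropy \<nu> t"
proof -
  have "(\<Sum>Q\<in>thr_partition \<nu> t. prob Q * log 2 (prob Q)) \<le> (\<Sum>Q\<in>thr_partition \<nu> t. prob Q * log 2 t)"
    using thr_partition_prob assms by (intro sum_mono mult_left_mono) (auto simp: less_imp_le)
  also have "\<dots> = log 2 t" using sum_prob_thr_partition[OF assms] by (simp flip: sum_distrib_right)
  finally show ?thesis using assms by (simp add: thr_entropy_def log_divide)
qed

lemma thr_card_pos:
  assumes "0 < t" "t < 1" shows "0 < thr_card \<nu> t"
proof -
  have "thr_partition \<nu> t \<noteq> {}" using sum_prob_thr_partition[OF assms] by force
  then show ?thesis using finite_thr_partition_card_le(1)[OF assms] by (simp add: thr_card_def card_gt_0_iff)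
qed

text \<open>Gibbs' inequality against the uniform distribution on the partition.\<close>

lemma thr_entropy_le_log_card:
  assumes "0 < t" "t < 1" shows "thr_entropy \<nu> t \<le> log 2 (real (thr_card \<nu> t))"
proof -
  have M: "0 < real (thr_card \<nu> t)" using thr_card_pos[OF assms] by simp
  have "thr_entropy \<nu> t \<le> - (\<Sum>Q\<in>thr_partition \<nu> t. prob Q * log 2 (1 / real (thr_card \<nu> t)))"
    unfolding thr_entropy_def using thr_partition_prob sum_prob_thr_partition[OF assms] M
    by (intro gibbs_inequality) (auto simp: thr_card_def)
  also have "\<dots> = log 2 (real (thr_card \<nu> t))"
    using sum_prob_thr_partition[OF assms] M
    by (simp only: sum_distrib_right[symmetric]) (simp add: log_divide)
  finally show ?thesis .
qed

text \<open>Gibbs' inequality against volumes, whose logarithms are the dimension times the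
  logarithms of the side lengths.\<close>

lemma thr_entropy_le_lyapunov:
  assumes "0 < t" "t < 1" shows "thr_entropy \<nu> t \<le> real CARD('n) * thr_lyapunov \<nu> t"
proof -
  have "thr_entropy \<nu> t \<le> - (\<Sum>Q\<in>thr_partition \<nu> t. prob Q * log 2 (side_length Q ^ CARD('n)))"
    unfolding thr_entropy_def
    using thr_partition_prob sum_prob_thr_partition[OF assms] sum_side_length_le_1[OF assms]
    by (intro gibbs_inequality) (auto simp: side_length_def)
  also have "\<dots> = real CARD('n) * thr_lyapunov \<nu> t"
    unfolding thr_lyapunov_def by (simp add: log_nat_power side_length_def sum_distrib_left mult_ac)
  finally show ?thesis .
qed

lemma log_le_thr_lyapunov:
  assumes "0 < t" "t < 1" shows "log 2 (1 / t) \<le> real CARD('n) * thr_lyapunov \<nu> t"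
  using log_le_thr_entropy[OF assms] thr_entropy_le_lyapunov[OF assms] by simp

lemma thr_lyapunov_pos:
  assumes "0 < t" "t < 1" shows "0 < thr_lyapunov \<nu> t"
proof -
  have "0 < log 2 (1 / t)" using assms by simp
  then have "0 < real CARD('n) * thr_lyapunov \<nu> t" using log_le_thr_lyapunov[OF assms] by linarith
  then show ?thesis by (simp add: zero_less_mult_iff)
qed

end

section \<open>Quantization error\<close>

lemma max_setdist_le:
  assumes "finite A" "y \<in> A" shows "max_setdist x A \<le> infnorm (x - y)"
  unfolding max_setdist_def using assms by (intro cINF_lower bdd_below_finite) auto

lemma max_setdist_attained:
  assumes "finite A" "A \<noteq> {}" obtains y where "y \<in> A" "max_setdist x A = infnorm (x - y)"
proof -
  have "max_setdist x A \<in> (\<lambda>y. infnorm (x - y)) ` A"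
    unfolding max_setdist_def using assms by (simp add: cInf_eq_Min)
  then show ?thesis using that by blast
qed

lemma max_setdist_nonneg: "finite A \<Longrightarrow> A \<noteq> {} \<Longrightarrow> 0 \<le> max_setdist x A"
  by (metis max_setdist_attained infnorm_pos_le)

lemma max_setdist_pos_iff: "finite A \<Longrightarrow> A \<noteq> {} \<Longrightarrow> 0 < max_setdist x A \<longleftrightarrow> x \<notin> A"
  by (smt (verit) max_setdist_attained max_setdist_le max_setdist_nonneg infnorm_eq_0 right_minus_eq)

lemma max_setdist_measurable [measurable]:
  assumes "finite A" "A \<noteq> {}"
  shows "(\<lambda>x. max_setdist x A) \<in> borel_measurable borel"
proof -
  have "(\<lambda>x. infnorm (x - y)) \<in> borel_measurable borel" for y :: "real ^ 'n"
    by (intro borel_measurable_continuous_onI continuous_on_infnorm continuous_intros)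
  then show ?thesis unfolding max_setdist_def using assms
    by (intro borel_measurable_cINF) (auto intro: countable_finite bdd_below_finite)
qed

context dyadic_decay
begin

text \<open>A point of the root cube lies in cubes of arbitrarily small mass, so it is no atom. Thus
  the value \<open>ln 0 = 0\<close> is met only on a null set.\<close>

lemma AE_not_in_finite:
  assumes "finite A" shows "AE x in \<nu>. x \<notin> A"
proof -
  have "AE x in \<nu>. x \<noteq> y" for y
  proof (cases "y \<in> root_cube")
    case True
    have "prob {y} \<le> C * 2 powr (- a * real k)" for k
      using finite_measure_mono[of "{y}" "cube_at k y"] cube_at_self[OF True] cube_at_borel[OF True]
        decay[OF True, of k] by fastforce
    then have "prob {y} \<le> 0"
      by (intro LIMSEQ_le_const[OF decay_tendsto_0]) auto
    then have "{y} \<in> null_sets \<nu>"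
      by (simp add: null_sets_def emeasure_eq_measure measure_le_0_iff)
    then show ?thesis by (rule AE_I') auto
  next
    case False
    show ?thesis using AE_root by eventually_elim (use False in auto)
  qed
  then have "AE x in \<nu>. \<forall>y\<in>A. x \<noteq> y" using assms by (simp add: AE_finite_all)
  then show ?thesis by eventually_elim auto
qed

text \<open>Only these points contribute to the excess of \<open>- log 2 (max_setdist x A)\<close> over the stopping level.\<close>

definition near_light :: "real \<Rightarrow> (real ^ 'n) set \<Rightarrow> nat \<Rightarrow> (real ^ 'n) set" where
  "near_light t A m = (\<Union>Q\<in>{Q \<in> dyadic_cubes m. prob Q < t}. {x \<in> Q. max_setdist x A < 1 / 2 ^ m})"

lemma near_light_borel:
  assumes "finite A" "A \<noteq> {}" shows "near_light t A m \<in> sets borel"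
  unfolding near_light_def
proof (intro sets.finite_UN)
  show "finite {Q \<in> dyadic_cubes m. prob Q < t}" by simp
  fix Q assume "Q \<in> {Q \<in> dyadic_cubes m. prob Q < t}"
  then have [measurable]: "Q \<in> sets borel" using cube_at_borel by (auto simp: dyadic_cubes_eq)
  have [measurable]: "(\<lambda>x. max_setdist x A) \<in> borel_measurable borel" using max_setdist_measurable[OF assms] .
  have "Q \<inter> {x \<in> space borel. max_setdist x A < 1 / 2 ^ m} \<in> sets borel" by measurable
  then show "{x \<in> Q. max_setdist x A < 1 / 2 ^ m} \<in> sets borel" by (simp add: Int_def conj_commute)
qed

text \<open>Each point of the set lies in a light cube coming within \<open>1 / 2 ^ m\<close> of
  some point of \<open>A\<close>, and every point of \<open>A\<close> has at most
  \<open>3 ^ d\<close> such cubes, \<open>d\<close> being the dimension.\<close>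

lemma prob_near_light_le:
  assumes "finite A" "A \<noteq> {}" "0 < t" "0 < \<theta>" "\<theta> < 1"
  shows "prob (near_light t A m) \<le>
    real (card A) * 3 ^ CARD('n) * (t powr \<theta> * (C * 2 powr (- a * real m)) powr (1 - \<theta>))"
proof -
  let ?b = "t powr \<theta> * (C * 2 powr (- a * real m)) powr (1 - \<theta>)"
  define N where "N = (\<lambda>y :: real ^ 'n. {Q \<in> dyadic_cubes m. \<exists>x\<in>Q. infnorm (x - y) < 1 / 2 ^ m})"
  define S where "S = (\<Union>y\<in>A. {Q \<in> N y. prob Q < t})"
  have finN: "finite (N y)" for y unfolding N_def by simp
  have finS: "finite S" unfolding S_def using finN assms(1) by auto
  have borel: "Q \<in> sets borel" if "Q \<in> S" for Q
    using that cube_at_borel by (auto simp: S_def N_def dyadic_cubes_eq)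
  have "near_light t A m \<subseteq> (\<Union>Q\<in>S. Q)"
  proof
    fix x assume "x \<in> near_light t A m"
    then obtain Q where Q: "Q \<in> dyadic_cubes m" "prob Q < t" "x \<in> Q" "max_setdist x A < 1 / 2 ^ m"
      unfolding near_light_def by blast
    obtain y where "y \<in> A" "max_setdist x A = infnorm (x - y)"
      using max_setdist_attained[OF assms(1,2)] by blast
    then show "x \<in> (\<Union>Q\<in>S. Q)" using Q unfolding S_def N_def by auto
  qed
  then have "prob (near_light t A m) \<le> prob (\<Union>Q\<in>S. Q)"
    using finS borel by (intro finite_measure_mono) auto
  also have "\<dots> \<le> (\<Sum>Q\<in>S. prob Q)"
    using finS borel by (intro finite_measure_subadditive_finite) auto
  also have "\<dots> \<le> (\<Sum>Q\<in>S. ?b)"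
  proof (rule sum_mono)
    fix Q assume "Q \<in> S"
    then obtain x where x: "x \<in> root_cube" "Q = cube_at m x" "prob Q < t"
      unfolding S_def N_def dyadic_cubes_eq by blast
    \<comment> \<open>Interpolating between the threshold bound and the decay bound makes the sum over \<open>m\<close> geometric
      while keeping a power of \<open>t\<close>.\<close>
    have "prob Q = prob Q powr \<theta> * prob Q powr (1 - \<theta>)" by (simp flip: powr_add)
    also have "\<dots> \<le> ?b"
      using x decay[OF x(1), of m] assms by (intro mult_mono powr_mono2) auto
    finally show "prob Q \<le> ?b" .
  qed
  also have "\<dots> = real (card S) * ?b" by simp
  also have "\<dots> \<le> real (card A * 3 ^ CARD('n)) * ?b"
  proof (intro mult_right_mono of_nat_mono)
    have "card S \<le> (\<Sum>y\<in>A. card {Q \<in> N y. prob Q < t})"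
      unfolding S_def using assms(1) by (rule card_UN_le)
    also have "\<dots> \<le> (\<Sum>y\<in>A. 3 ^ CARD('n))"
    proof (rule sum_mono)
      fix y
      have "card {Q \<in> N y. prob Q < t} \<le> card (N y)" using finN by (intro card_mono) auto
      also have "\<dots> \<le> 3 ^ CARD('n)" unfolding N_def by (rule card_near_cubes_le)
      finally show "card {Q \<in> N y. prob Q < t} \<le> 3 ^ CARD('n)" .
    qed
    finally show "card S \<le> card A * 3 ^ CARD('n)" by simp
  qed simp
  finally show ?thesis by simp
qed

text \<open>The geometric series over \<open>m\<close> of the bounds in
  \<open>prob_near_light_le\<close>, with the factor \<open>card A * t powr \<theta>\<close> taken
  out; its ratio is below \<open>1\<close> because \<open>\<theta> < 1\<close>.\<close>

definition excess_bound :: "nat \<Rightarrow> real \<Rightarrow> real" where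
  "excess_bound d \<theta> = 3 ^ d * C powr (1 - \<theta>) / (1 - 2 powr (- a * (1 - \<theta>)))"

lemma excess_bound_nonneg:
  assumes "\<theta> < 1" shows "0 \<le> excess_bound d \<theta>"
  unfolding excess_bound_def using a_pos assms powr_less_one[of 2 "- a * (1 - \<theta>)"]
  by (simp add: mult_less_0_iff)

lemma nn_integral_near_light_le:
  assumes "finite A" "A \<noteq> {}" "0 < t" "0 < \<theta>" "\<theta> < 1"
  shows "(\<integral>\<^sup>+x. (\<Sum>m. indicator (near_light t A m) x) \<partial>\<nu>)
    \<le> ennreal (real (card A) * t powr \<theta> * excess_bound CARD('n) \<theta>)"
proof -
  define r where "r = 2 powr (- a * (1 - \<theta>))"
  have r: "0 \<le> r" "r < 1" unfolding r_def using a_pos assms by (auto intro!: powr_less_one mult_pos_pos)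
  let ?c = "real (card A) * 3 ^ CARD('n) * t powr \<theta> * C powr (1 - \<theta>)"
  have rm: "(C * 2 powr (- a * real m)) powr (1 - \<theta>) = C powr (1 - \<theta>) * r ^ m" for m
    using C_ge_1 by (simp add: powr_mult powr_powr r_def flip: powr_realpow) (simp add: mult_ac powr_powr)
  have "(\<integral>\<^sup>+x. (\<Sum>m. indicator (near_light t A m) x) \<partial>\<nu>) = (\<Sum>m. \<integral>\<^sup>+x. indicator (near_light t A m) x \<partial>\<nu>)"
    using near_light_borel[OF assms(1,2)] by (intro nn_integral_suminf) auto
  also have "\<dots> = (\<Sum>m. ennreal (prob (near_light t A m)))"
    using near_light_borel[OF assms(1,2)] by (simp add: emeasure_eq_measure)
  also have "\<dots> \<le> (\<Sum>m. ennreal (?c * r ^ m))"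
  proof (intro suminf_le ennreal_leI)
    show "prob (near_light t A m) \<le> ?c * r ^ m" for m
      using prob_near_light_le[OF assms, of m] unfolding rm by (simp add: mult_ac)
  qed auto
  also have "\<dots> = ennreal (\<Sum>m. ?c * r ^ m)"
    using r by (intro suminf_ennreal2) (auto intro!: summable_mult summable_geometric)
  also have "(\<Sum>m. ?c * r ^ m) = ?c * (1 / (1 - r))"
    using r by (subst suminf_mult) (auto simp: suminf_geometric summable_geometric)
  also have "\<dots> = real (card A) * t powr \<theta> * excess_bound CARD('n) \<theta>"
    by (simp add: excess_bound_def r_def)
  finally show ?thesis .
qed

text \<open>Let \<open>n\<close> be \<open>- log 2\<close> of the distance, rounded up; then every
  \<open>m < n\<close> has distance below \<open>1 / 2 ^ m\<close>. At most
  \<open>stop_level t x\<close> of these \<open>m\<close> lie below the stopping level, and for the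
  others the cube around \<open>x\<close> is light, so \<open>near_light\<close> counts
  them.\<close>

lemma neg_log_max_setdist_le:
  assumes "finite A" "A \<noteq> {}" "0 < t" "t < 1" "x \<in> root_cube" "x \<notin> A"
  shows "ennreal (- log 2 (max_setdist x A))
    \<le> ennreal (real (stop_level t x)) + (\<Sum>m. indicator (near_light t A m) x)"
proof -
  let ?d = "max_setdist x A" and ?k = "stop_level t x"
  have d: "0 < ?d" using max_setdist_pos_iff[OF assms(1,2)] assms(6) by simp
  show ?thesis
  proof (cases "?d < 1")
    \<comment> \<open>Negative arguments of \<open>ennreal\<close> become \<open>0\<close>, which
      settles the points at distance at least \<open>1\<close>.\<close>
    case False
    then have "- log 2 ?d \<le> 0" by simp
    then show ?thesis by (simp add: ennreal_neg)
  next
    case True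
    define n where "n = nat \<lceil>- log 2 ?d\<rceil>"
    have pos: "0 < - log 2 ?d" using True d by simp
    then have n: "- log 2 ?d \<le> real n" "real n < - log 2 ?d + 1" unfolding n_def by linarith+
    have mem: "x \<in> near_light t A m" if "m \<in> {?k..<n}" for m
    proof -
      have "real m + 1 \<le> real n" using that by auto
      then have "log 2 ?d < - real m" using n by linarith
      then have "?d < 2 powr (- real m)" using d by (simp add: log_less_iff)
      then have "?d < 1 / 2 ^ m" by (simp add: powr_minus powr_realpow inverse_eq_divide)
      moreover have "prob (cube_at m x) < t" using that stop_level_le_iff[OF assms(5,3)] by simp
      ultimately show ?thesis
        unfolding near_light_def dyadic_cubes_eq using cube_at_self[OF assms(5)] assms(5) by blast
    qed
    have "ennreal (- log 2 ?d) \<le> ennreal (real n)" using n by (intro ennreal_leI)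
    \<comment> \<open>This covers \<open>n \<le> ?k\<close> too, where the index range is
      empty.\<close>
    also have "\<dots> \<le> ennreal (real ?k + (\<Sum>m\<in>{?k..<n}. 1))" by (intro ennreal_leI) simp
    also have "\<dots> = ennreal (real ?k) + (\<Sum>m\<in>{?k..<n}. 1)"
      by (subst ennreal_plus) (auto simp: ennreal_of_nat_eq_real_of_nat)
    also have "(\<Sum>m\<in>{?k..<n}. 1) = (\<Sum>m\<in>{?k..<n}. indicator (near_light t A m) x :: ennreal)"
      using mem by (intro sum.cong) auto
    also have "\<dots> \<le> (\<Sum>m. indicator (near_light t A m) x)"
      by (intro sum_le_suminf) auto
    finally show ?thesis by (simp add: add_left_mono)
  qed
qed

text \<open>Integrating the pointwise estimate bounds the negative part of the logarithm, and the
  positive part is bounded on the root cube. Hence the logarithm is integrable and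
  \<open>geo_mean_dist\<close> does not fall back on its default \<open>0\<close>.\<close>

lemma geo_mean_dist_lower:
  assumes "finite A" "A \<noteq> {}" "0 < t" "t < 1" "0 < \<theta>" "\<theta> < 1"
  shows "2 powr (- (thr_lyapunov \<nu> t + real (card A) * t powr \<theta> * excess_bound CARD('n) \<theta>)) \<le> geo_mean_dist \<nu> A"
    and "integrable \<nu> (\<lambda>x. ln (max_setdist x A))"
proof -
  let ?l = "\<lambda>x. log 2 (max_setdist x A)" and ?L = "thr_lyapunov \<nu> t"
  let ?B = "real (card A) * t powr \<theta> * excess_bound CARD('n) \<theta>"
  have B: "0 \<le> ?B"
    using excess_bound_nonneg[OF assms(6)] by simp
  have [measurable]: "(\<lambda>x. max_setdist x A) \<in> borel_measurable borel" using max_setdist_measurable[OF assms(1,2)] .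
  have [measurable]: "near_light t A m \<in> sets borel" for m using near_light_borel[OF assms(1,2)] .
  have lm [measurable]: "level_fun t \<in> borel_measurable \<nu>"
    using has_integral_level_fun[OF assms(3,4)] by (auto simp: has_bochner_integral_iff)
  have L: "(\<integral>\<^sup>+x. ennreal (level_fun t x) \<partial>\<nu>) = ennreal ?L"
  proof -
    have "0 \<le> level_fun t x" for x unfolding level_fun_def by (intro sum_nonneg) auto
    then show ?thesis using has_integral_level_fun[OF assms(3,4)]
      by (simp add: nn_integral_eq_integral has_bochner_integral_iff)
  qed
  have "(\<integral>\<^sup>+x. ennreal (- ?l x) \<partial>\<nu>) \<le> (\<integral>\<^sup>+x. ennreal (level_fun t x) + (\<Sum>m. indicator (near_light t A m) x) \<partial>\<nu>)"
  proof (rule nn_integral_mono_AE)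
    show "AE x in \<nu>. ennreal (- ?l x) \<le> ennreal (level_fun t x) + (\<Sum>m. indicator (near_light t A m) x)"
      using AE_level_fun[OF assms(3,4)] AE_not_in_finite[OF assms(1)]
      by eventually_elim (use neg_log_max_setdist_le[OF assms(1-4)] in auto)
  qed
  also have "\<dots> = (\<integral>\<^sup>+x. ennreal (level_fun t x) \<partial>\<nu>) + (\<integral>\<^sup>+x. (\<Sum>m. indicator (near_light t A m) x) \<partial>\<nu>)"
    by (intro nn_integral_add) measurable
  also have "\<dots> \<le> ennreal ?L + ennreal ?B"
    unfolding L using nn_integral_near_light_le[OF assms(1-3,5,6)] by (intro add_left_mono)
  also have "\<dots> = ennreal (?L + ?B)"
    using B thr_lyapunov_pos[OF assms(3,4)] by (simp add: ennreal_plus)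
  finally have neg: "(\<integral>\<^sup>+x. ennreal (- ?l x) \<partial>\<nu>) \<le> ennreal (?L + ?B)" .
  obtain y where y: "y \<in> A" using assms(2) by blast
  \<comment> \<open>Points of the root cube have norm at most \<open>1\<close>, so their distance to
    \<open>y\<close> is at most \<open>1 + infnorm y\<close>.\<close>
  define w where "w = log 2 (1 + infnorm y)"
  have w: "0 \<le> w" unfolding w_def using infnorm_pos_le[of y] by simp
  have up: "?l x \<le> w" if "x \<in> root_cube" "x \<notin> A" for x
  proof -
    have "infnorm x \<le> 1" using that(1) by (simp add: infnorm_le_iff root_cube_def)
    then have "max_setdist x A \<le> 1 + infnorm y"
      using max_setdist_le[OF assms(1) y, of x] infnorm_triangle[of x "- y"] by (simp add: infnorm_neg)
    then show ?thesis unfolding w_def using max_setdist_pos_iff[OF assms(1,2), of x] that(2) by (intro log_mono) auto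
  qed
  have int: "integrable \<nu> ?l"
  proof (rule integrableI_bounded)
    have "(\<integral>\<^sup>+x. ennreal (norm (?l x)) \<partial>\<nu>) \<le> (\<integral>\<^sup>+x. ennreal (- ?l x) + ennreal w \<partial>\<nu>)"
    proof (rule nn_integral_mono_AE)
      show "AE x in \<nu>. ennreal (norm (?l x)) \<le> ennreal (- ?l x) + ennreal w"
        using AE_root AE_not_in_finite[OF assms(1)]
      proof eventually_elim
        case (elim x)
        show ?case
        proof (cases "0 \<le> ?l x")
          case True
          then have "ennreal (norm (?l x)) \<le> ennreal w" using up[OF elim] by (simp add: ennreal_leI)
          then show ?thesis by (simp add: add_increasing)
        next
          case False
          then show ?thesis by (simp add: add_increasing2)
        qed
      qed
    qed
    also have "\<dots> = (\<integral>\<^sup>+x. ennreal (- ?l x) \<partial>\<nu>) + ennreal w"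
      by (subst nn_integral_add) (auto simp: emeasure_space_1[simplified])
    also have "\<dots> < \<infinity>" using neg by (simp add: ennreal_add_less_top le_less_trans[OF neg])
    finally show "(\<integral>\<^sup>+x. ennreal (norm (?l x)) \<partial>\<nu>) < \<infinity>" .
  qed measurable
  have ln_eq: "ln (max_setdist x A) = ln 2 * ?l x" for x by (simp add: log_def)
  then show int_ln: "integrable \<nu> (\<lambda>x. ln (max_setdist x A))" using int by simp
  \<comment> \<open>The integral is the difference of the integrals of the two parts; the subtracted
    one is dropped.\<close>
  have "(\<integral>x. - ?l x \<partial>\<nu>) \<le> enn2real (\<integral>\<^sup>+x. ennreal (- ?l x) \<partial>\<nu>)"
    using int by (subst real_lebesgue_integral_def) auto
  also have "\<dots> \<le> enn2real (ennreal (?L + ?B))" by (rule enn2real_mono[OF neg]) simp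
  also have "\<dots> = ?L + ?B" using B thr_lyapunov_pos[OF assms(3,4)] by simp
  finally have "- (?L + ?B) \<le> (\<integral>x. ?l x \<partial>\<nu>)" by simp
  then have "2 powr (- (?L + ?B)) \<le> 2 powr (\<integral>x. ?l x \<partial>\<nu>)" by (intro powr_mono) auto
  also have "\<dots> = exp (\<integral>x. ln (max_setdist x A) \<partial>\<nu>)"
    unfolding ln_eq by (simp add: powr_def mult.commute)
  also have "\<dots> = geo_mean_dist \<nu> A"
  proof -
    have "AE x in \<nu>. 0 < max_setdist x A"
      using AE_not_in_finite[OF assms(1)] by eventually_elim (simp add: max_setdist_pos_iff[OF assms(1,2)])
    then show ?thesis using int_ln by (simp add: geo_mean_dist_def)
  qed
  finally show "2 powr (- (?L + ?B)) \<le> geo_mean_dist \<nu> A" .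
qed

section \<open>Bounds for the quantization error\<close>

lemma quant_error0_lower:
  assumes "0 < t" "t < 1" "0 < \<theta>" "\<theta> < 1" "1 \<le> N"
  shows "2 powr (- (thr_lyapunov \<nu> t + real N * t powr \<theta> * excess_bound CARD('n) \<theta>)) \<le> quant_error0 \<nu> N"
  unfolding quant_error0_def
proof (rule cINF_greatest)
  have "{0 :: real ^ 'n} \<in> {A. finite A \<and> 1 \<le> card A \<and> card A \<le> N}" using assms(5) by simp
  then show "{A :: (real ^ 'n) set. finite A \<and> 1 \<le> card A \<and> card A \<le> N} \<noteq> {}" by blast
  fix A :: "(real ^ 'n) set" assume A: "A \<in> {A. finite A \<and> 1 \<le> card A \<and> card A \<le> N}"
  have "real (card A) * (t powr \<theta> * excess_bound CARD('n) \<theta>) \<le> real N * (t powr \<theta> * excess_bound CARD('n) \<theta>)"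
    using A excess_bound_nonneg[OF assms(4)] by (intro mult_right_mono) auto
  then have "2 powr (- (thr_lyapunov \<nu> t + real N * t powr \<theta> * excess_bound CARD('n) \<theta>))
      \<le> 2 powr (- (thr_lyapunov \<nu> t + real (card A) * t powr \<theta> * excess_bound CARD('n) \<theta>))"
    by (intro powr_mono) (auto simp: mult.assoc)
  also have "\<dots> \<le> geo_mean_dist \<nu> A"
    using A assms by (intro geo_mean_dist_lower) auto
  finally show "2 powr (- (thr_lyapunov \<nu> t + real N * t powr \<theta> * excess_bound CARD('n) \<theta>)) \<le> geo_mean_dist \<nu> A" .
qed

text \<open>Any admissible \<open>t\<close> and \<open>\<theta>\<close> would do. Positivity keeps
  the logarithm of the error away from the default \<open>log 2 0 = 0\<close>.\<close>

lemma quant_error0_pos: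
  assumes "1 \<le> N" shows "0 < quant_error0 \<nu> N"
  using quant_error0_lower[of "1/2" "1/2" N] assms by (smt (verit) field_sum_of_halves powr_gt_zero)

text \<open>The competitor picks one point from each partition cube; almost every \<open>x\<close>
  then has a neighbour within the side length of its stopped cube.\<close>

lemma quant_error0_upper:
  assumes "0 < t" "t < 1" "thr_card \<nu> t \<le> N"
  shows "quant_error0 \<nu> N \<le> 2 powr (- thr_lyapunov \<nu> t)"
proof -
  define pt where "pt = (\<lambda>Q :: (real ^ 'n) set. SOME x. x \<in> Q)"
  define A where "A = pt ` thr_partition \<nu> t"
  have finP: "finite (thr_partition \<nu> t)" by (rule finite_thr_partition_card_le[OF assms(1,2)])
  have ne: "thr_partition \<nu> t \<noteq> {}"
    using thr_card_pos[OF assms(1,2)] by (auto simp: thr_card_def)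
  have A: "finite A" "A \<noteq> {}" "card A \<le> N"
    unfolding A_def using finP ne card_image_le[OF finP, of pt] assms(3) by (auto simp: thr_card_def)
  have int: "integrable \<nu> (\<lambda>x. ln (max_setdist x A))"
    by (rule geo_mean_dist_lower(2)[OF A(1,2) assms(1,2), of "1/2"]) auto
  have hl: "integrable \<nu> (level_fun t)" "(\<integral>x. level_fun t x \<partial>\<nu>) = thr_lyapunov \<nu> t"
    using has_integral_level_fun[OF assms(1,2)] by (auto simp: has_bochner_integral_iff)
  have "(\<integral>x. ln (max_setdist x A) \<partial>\<nu>) \<le> (\<integral>x. - ln 2 * level_fun t x \<partial>\<nu>)"
  proof (rule integral_mono_AE)
    show "AE x in \<nu>. ln (max_setdist x A) \<le> - ln 2 * level_fun t x"
      using AE_level_fun[OF assms(1,2)] AE_not_in_finite[OF A(1)]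
    proof eventually_elim
      case (elim x)
      let ?Q = "stop_cube t x"
      have "pt ?Q \<in> ?Q" unfolding pt_def using stop_cube_self elim by (metis someI_ex)
      then have "infnorm (x - pt ?Q) \<le> 1 / 2 ^ stop_level t x"
        using infnorm_cube_at_le[of x "pt ?Q" "stop_level t x"] elim by (simp add: stop_cube_def)
      moreover have "pt ?Q \<in> A" using elim by (simp add: A_def)
      ultimately have "max_setdist x A \<le> 1 / 2 ^ stop_level t x"
        using max_setdist_le[OF A(1), of "pt ?Q" x] by linarith
      moreover have "0 < max_setdist x A" using max_setdist_pos_iff[OF A(1,2)] elim by simp
      ultimately have "ln (max_setdist x A) \<le> ln (1 / 2 ^ stop_level t x)" by simp
      also have "\<dots> = - ln 2 * level_fun t x" using elim by (simp add: ln_div ln_realpow)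
      finally show ?case .
    qed
  qed (use int hl in auto)
  also have "\<dots> = - ln 2 * thr_lyapunov \<nu> t" using hl by simp
  finally have "exp (\<integral>x. ln (max_setdist x A) \<partial>\<nu>) \<le> 2 powr (- thr_lyapunov \<nu> t)"
    by (simp add: powr_def mult.commute)
  \<comment> \<open>Both branches of \<open>geo_mean_dist\<close> satisfy the bound, the default
    \<open>0\<close> trivially.\<close>
  then have "geo_mean_dist \<nu> A \<le> 2 powr (- thr_lyapunov \<nu> t)" by (simp add: geo_mean_dist_def)
  moreover have "quant_error0 \<nu> N \<le> geo_mean_dist \<nu> A"
    unfolding quant_error0_def
  proof (rule cINF_lower)
    show "bdd_below (geo_mean_dist \<nu> ` {A. finite A \<and> 1 \<le> card A \<and> card A \<le> N})"
      by (rule bdd_belowI2[where m = 0]) (simp add: geo_mean_dist_def)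
    show "A \<in> {A. finite A \<and> 1 \<le> card A \<and> card A \<le> N}" using A by (simp add: Suc_le_eq card_gt_0_iff)
  qed
  ultimately show ?thesis by linarith
qed

abbreviation card_const :: "nat \<Rightarrow> real" where
  "card_const d \<equiv> 2 ^ d * max (1 + log 2 C / a) (1 / a)"

lemma card_const_ge_1: "1 \<le> card_const CARD('n)"
proof -
  have "1 \<le> 1 + log 2 C / a" using C_ge_1 a_pos by simp
  then have "1 \<le> max (1 + log 2 C / a) (1 / a)" by linarith
  then have "1 * 1 \<le> card_const CARD('n)" by (intro mult_mono) auto
  then show ?thesis by simp
qed

lemma quant_dim0_eq_log_ratio:
  shows "lower_quant_dim0 \<nu> = Liminf (at_right 0) (\<lambda>t. ereal (log 2 (1 / t) / thr_lyapunov \<nu> t))"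
    and "upper_quant_dim0 \<nu> = Limsup (at_right 0) (\<lambda>t. ereal (log 2 (1 / t) / thr_lyapunov \<nu> t))"
proof -
  have pow01: "0 < real N powr - s" "real N powr - s < 1" if "N \<ge> 2" "s > 0" for N s
    using that powr_less_one[of "real N" "- s"] by auto
  have up: "eventually (\<lambda>N. thr_lyapunov \<nu> (real N powr - s) \<le> - log 2 (quant_error0 \<nu> N)) sequentially"
    if s: "0 < s" "s < 1" for s
  proof -
    have "0 < card_const CARD('n)" using card_const_ge_1 by linarith
    \<comment> \<open>For \<open>t = N powr - s\<close> this quantity bounds
      \<open>thr_card \<nu> t / N\<close>; it vanishes in the limit because \<open>s < 1\<close>
      beats the logarithm.\<close>
    then have "((\<lambda>N. card_const CARD('n) * real N powr (s - 1) * (1 + s * log 2 (real N))) \<longlonglongrightarrow> 0)"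
      using s by real_asymp
    then have "eventually (\<lambda>N. card_const CARD('n) * real N powr (s - 1) * (1 + s * log 2 (real N)) < 1) sequentially"
      by (rule order_tendstoD) simp
    then show ?thesis using eventually_ge_at_top[of "2::nat"]
    proof eventually_elim
      case (elim N)
      let ?t = "real N powr - s"
      note t = pow01[OF elim(2) s(1)]
      have "real (thr_card \<nu> ?t) \<le> card_const CARD('n) * (1 / ?t) * (1 + log 2 (1 / ?t))"
        by (rule finite_thr_partition_card_le(2)[OF t])
      also have "1 / ?t = real N powr (s - 1) * real N"
        using elim by (simp add: powr_minus_divide powr_diff)
      also have "log 2 (real N powr (s - 1) * real N) = s * log 2 (real N)"
        using elim by (simp add: log_mult log_powr algebra_simps)
      also have "card_const CARD('n) * (real N powr (s - 1) * real N) * (1 + s * log 2 (real N))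
          = (card_const CARD('n) * real N powr (s - 1) * (1 + s * log 2 (real N))) * real N"
        by (simp only: mult_ac)
      also have "\<dots> \<le> 1 * real N" using elim by (intro mult_right_mono) auto
      finally have "thr_card \<nu> ?t \<le> N" by simp
      then have "quant_error0 \<nu> N \<le> 2 powr (- thr_lyapunov \<nu> ?t)" by (rule quant_error0_upper[OF t])
      then have "log 2 (quant_error0 \<nu> N) \<le> log 2 (2 powr (- thr_lyapunov \<nu> ?t))"
        using quant_error0_pos[of N] elim by (subst log_le_cancel_iff) auto
      then show ?case by simp
    qed
  qed
  have low: "eventually (\<lambda>N. - log 2 (quant_error0 \<nu> N) \<le> thr_lyapunov \<nu> (real N powr - s) + 1) sequentially"
    if s: "1 < s" for s
  proof -
    \<comment> \<open>The midpoint of \<open>1 / s\<close> and \<open>1\<close>: then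
      \<open>\<theta> < 1\<close> keeps \<open>excess_bound\<close> finite, while
      \<open>s * \<theta> > 1\<close> lets
      \<open>N * t powr \<theta> = N powr (1 - s * \<theta>)\<close> tend to
      \<open>0\<close>.\<close>
    define \<theta> where "\<theta> = (1 + 1 / s) / 2"
    have \<theta>: "0 < \<theta>" "\<theta> < 1" "1 - s * \<theta> < 0" using s by (auto simp: \<theta>_def field_simps)
    have "((\<lambda>N. real N powr (1 - s * \<theta>) * excess_bound CARD('n) \<theta>) \<longlonglongrightarrow> 0)"
      using \<theta>(3) by real_asymp
    then have "eventually (\<lambda>N. real N powr (1 - s * \<theta>) * excess_bound CARD('n) \<theta> < 1) sequentially"
      by (rule order_tendstoD) simp
    then show ?thesis using eventually_ge_at_top[of "2::nat"]
    proof eventually_elim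
      case (elim N)
      let ?t = "real N powr - s"
      have "0 < s" using s by simp
      note t = pow01[OF elim(2) this]
      have q: "2 powr (- (thr_lyapunov \<nu> ?t + real N * ?t powr \<theta> * excess_bound CARD('n) \<theta>)) \<le> quant_error0 \<nu> N"
        using elim by (intro quant_error0_lower[OF t \<theta>(1,2)]) auto
      have eq: "real N * ?t powr \<theta> = real N powr (1 - s * \<theta>)"
        by (simp add: powr_powr powr_mult_base)
      have "2 powr (- (thr_lyapunov \<nu> ?t + 1))
          \<le> 2 powr (- (thr_lyapunov \<nu> ?t + real N powr (1 - s * \<theta>) * excess_bound CARD('n) \<theta>))"
        using elim(1) by (intro powr_mono) auto
      from order_trans[OF this q[unfolded eq]] have "2 powr (- (thr_lyapunov \<nu> ?t + 1)) \<le> quant_error0 \<nu> N" .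
      then have "log 2 (2 powr (- (thr_lyapunov \<nu> ?t + 1))) \<le> log 2 (quant_error0 \<nu> N)"
        using quant_error0_pos[of N] elim by (subst log_le_cancel_iff) auto
      then show ?case by simp
    qed
  qed
  have d: "0 < real CARD('n)" by simp
  show "lower_quant_dim0 \<nu> = Liminf (at_right 0) (\<lambda>t. ereal (log 2 (1 / t) / thr_lyapunov \<nu> t))"
    "upper_quant_dim0 \<nu> = Limsup (at_right 0) (\<lambda>t. ereal (log 2 (1 / t) / thr_lyapunov \<nu> t))"
    unfolding lower_quant_dim0_def upper_quant_dim0_def
    by (rule liminf_limsup_log_quotient[OF d log_le_thr_lyapunov thr_lyapunov_antimono up low]; assumption)+
qed

section \<open>From the logarithmic ratio to the entropy ratio\<close>

lemma log_thr_card_le: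
  assumes "0 < t" "t < 1" "1 \<le> C1"
    and card: "real (thr_card \<nu> t) \<le> C1 * (1 / t) * (1 + log 2 (1 / t))"
  shows "log 2 (real (thr_card \<nu> t)) \<le> log 2 (1 / t) + log 2 (C1 * (1 + log 2 (1 / t)))"
proof -
  have pos: "0 < 1 + log 2 (1 / t)" using assms by (simp add: add_pos_pos)
  have "log 2 (real (thr_card \<nu> t)) \<le> log 2 ((1 / t) * (C1 * (1 + log 2 (1 / t))))"
    using card thr_card_pos[OF assms(1,2)] by (intro log_mono) (auto simp: mult_ac)
  also have "\<dots> = log 2 (1 / t) + log 2 (C1 * (1 + log 2 (1 / t)))"
    using assms pos by (intro log_mult_pos) auto
  finally show ?thesis .
qed

text \<open>Over the common denominator \<open>L\<close> the numerator is
  \<open>H - log 2 (1 / t)\<close>, controlled by the chain of entropy bounds, and \<open>L\<close>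
  is at least \<open>log 2 (1 / t)\<close> divided by the dimension.\<close>

lemma thr_ratio_diff_bounds:
  assumes "0 < t" "t < 1" "1 \<le> C1"
    and card: "real (thr_card \<nu> t) \<le> C1 * (1 / t) * (1 + log 2 (1 / t))"
  shows "0 \<le> thr_ratio \<nu> t - log 2 (1 / t) / thr_lyapunov \<nu> t"
    and "thr_ratio \<nu> t - log 2 (1 / t) / thr_lyapunov \<nu> t
      \<le> real CARD('n) * (log 2 (C1 * (1 + log 2 (1 / t))) / log 2 (1 / t))"
proof -
  let ?L = "thr_lyapunov \<nu> t" and ?l = "log 2 (1 / t)" and ?e = "log 2 (C1 * (1 + log 2 (1 / t)))"
  have L: "0 < ?L" by (rule thr_lyapunov_pos[OF assms(1,2)])
  have l: "0 < ?l" using assms by simp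
  have eq: "thr_ratio \<nu> t - ?l / ?L = (thr_entropy \<nu> t - ?l) / ?L"
    by (simp add: thr_ratio_def diff_divide_distrib)
  have h: "0 \<le> thr_entropy \<nu> t - ?l" "thr_entropy \<nu> t - ?l \<le> ?e"
    using log_le_thr_entropy[OF assms(1,2)] thr_entropy_le_log_card[OF assms(1,2)] log_thr_card_le[OF assms]
    by linarith+
  show "0 \<le> thr_ratio \<nu> t - ?l / ?L" unfolding eq using h L by simp
  have "(thr_entropy \<nu> t - ?l) / ?L \<le> ?e / (?l / real CARD('n))"
    using h l log_le_thr_lyapunov[OF assms(1,2)] by (intro frac_le) (auto simp: field_simps)
  then show "thr_ratio \<nu> t - ?l / ?L \<le> real CARD('n) * (?e / ?l)"
    unfolding eq by (simp add: mult.commute)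
qed

lemma thr_ratio_error_tendsto_0:
  assumes "1 \<le> C1"
  shows "((\<lambda>t. real CARD('n) * (log 2 (C1 * (1 + log 2 (1 / t))) / log 2 (1 / t))) \<longlongrightarrow> 0) (at_right 0)"
proof -
  have "0 < C1" using assms by simp
  then have "((\<lambda>t. log 2 (C1 * (1 + log 2 (1 / t))) / log 2 (1 / t)) \<longlongrightarrow> 0) (at_right 0)"
    by real_asymp
  then show ?thesis by (rule tendsto_mult_right_zero)
qed

text \<open>The explicit constant \<open>card_const\<close> serves as \<open>C1\<close>, since its
  cardinality bound is proved for all \<open>t\<close> in question.\<close>

lemma thr_ratio_diff_tendsto_0:
  "((\<lambda>t. thr_ratio \<nu> t - log 2 (1 / t) / thr_lyapunov \<nu> t) \<longlongrightarrow> 0) (at_right 0)"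
proof (rule tendsto_sandwich[OF _ _ tendsto_const thr_ratio_error_tendsto_0[OF card_const_ge_1]])
  have "eventually (\<lambda>t::real. t \<in> {0<..<1}) (at_right 0)" by (rule eventually_at_right_real) simp
  then show "eventually (\<lambda>t. 0 \<le> thr_ratio \<nu> t - log 2 (1 / t) / thr_lyapunov \<nu> t) (at_right 0)"
    and "eventually (\<lambda>t. thr_ratio \<nu> t - log 2 (1 / t) / thr_lyapunov \<nu> t
      \<le> real CARD('n) * (log 2 (card_const CARD('n) * (1 + log 2 (1 / t))) / log 2 (1 / t))) (at_right 0)"
    by (eventually_elim, use thr_ratio_diff_bounds[OF _ _ card_const_ge_1 finite_thr_partition_card_le(2)] in auto)+
qed

lemma quant_dim0_eq_thr_ratio:
  "lower_quant_dim0 \<nu> = Liminf (at_right 0) (\<lambda>t. ereal (thr_ratio \<nu> t))"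
  "upper_quant_dim0 \<nu> = Limsup (at_right 0) (\<lambda>t. ereal (thr_ratio \<nu> t))"
  unfolding quant_dim0_eq_log_ratio
  using Liminf_Limsup_eq_of_diff_tendsto_0[OF _ thr_ratio_diff_tendsto_0] by simp_all

text \<open>The change to powers of \<open>N\<close> is made for \<open>log 2 (1 / t) / L t\<close>,
  where \<open>L\<close> is monotone; \<open>thr_ratio\<close> follows because the difference tends
  to \<open>0\<close> along the powers as well.\<close>

lemma quant_dim0_eq_thr_ratio_powr:
  assumes "c > 0"
  shows "lower_quant_dim0 \<nu> = liminf (\<lambda>N. ereal (thr_ratio \<nu> (real N powr (- c))))"
    and "upper_quant_dim0 \<nu> = limsup (\<lambda>N. ereal (thr_ratio \<nu> (real N powr (- c))))"
proof -
  have d: "0 < real CARD('n)" by simp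
  note diff = filterlim_compose[OF thr_ratio_diff_tendsto_0 filterlim_powr_at_right_0[OF assms]]
  note ratio = Liminf_Limsup_eq_of_diff_tendsto_0[OF sequentially_bot diff]
  show "lower_quant_dim0 \<nu> = liminf (\<lambda>N. ereal (thr_ratio \<nu> (real N powr (- c))))"
    and "upper_quant_dim0 \<nu> = limsup (\<lambda>N. ereal (thr_ratio \<nu> (real N powr (- c))))"
    by (simp_all only: quant_dim0_eq_log_ratio ratio
        Liminf_Limsup_log_ratio_powr[OF assms d thr_lyapunov_antimono log_le_thr_lyapunov])
qed

end

text \<open>The first conjunct exhibits an admissible \<open>C\<^sub>1\<close>, so the second is not
  vacuous; finiteness is stated with it because \<open>card\<close> is \<open>0\<close> on infinite
  sets.\<close>

theorem lemma2p10:
  fixes \<nu> :: "(real ^ 'n) measure" and a C :: real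
  assumes "prob_space \<nu>" and "sets \<nu> = sets borel"
    and "msupport \<nu> \<subseteq> interior root_cube"
    and "a > 0" and "C \<ge> 1"
    and "\<And>k Q. Q \<in> dyadic_cubes k \<Longrightarrow> measure \<nu> Q \<le> C * 2 powr (- a * real k)"
  shows
    "(let C\<^sub>0 = 2 ^ CARD('n) * max (1 + log 2 C / a) (1 / a) in
        C\<^sub>0 \<ge> 1 \<and>
        (\<forall>t. 0 < t \<and> t < 1 \<longrightarrow>
           finite (thr_partition \<nu> t) \<and>
           real (thr_card \<nu> t) \<le> C\<^sub>0 * (1 / t) * (1 + log 2 (1 / t))))
     \<and> (\<forall>C\<^sub>1 \<ge> 1.
          (\<forall>t. 0 < t \<and> t < 1 \<longrightarrow> real (thr_card \<nu> t) \<le> C\<^sub>1 * (1 / t) * (1 + log 2 (1 / t))) \<longrightarrow>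
            (\<forall>t. 0 < t \<and> t < 1 \<longrightarrow>
               log 2 (1 / t) \<le> thr_entropy \<nu> t \<and>
               thr_entropy \<nu> t \<le> log 2 (real (thr_card \<nu> t)) \<and>
               log 2 (real (thr_card \<nu> t)) \<le> log 2 (1 / t) + log 2 (C\<^sub>1 * (1 + log 2 (1 / t))) \<and>
               0 \<le> thr_ratio \<nu> t - log 2 (1 / t) / thr_lyapunov \<nu> t \<and>
               thr_ratio \<nu> t - log 2 (1 / t) / thr_lyapunov \<nu> t
                 \<le> real CARD('n) * (log 2 (C\<^sub>1 * (1 + log 2 (1 / t))) / log 2 (1 / t)))
            \<and> ((\<lambda>t. real CARD('n) * (log 2 (C\<^sub>1 * (1 + log 2 (1 / t))) / log 2 (1 / t))) \<longlongrightarrow> 0)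
                (at_right 0))
     \<and> lower_quant_dim0 \<nu> = Liminf (at_right 0) (\<lambda>t. ereal (thr_ratio \<nu> t))
     \<and> upper_quant_dim0 \<nu> = Limsup (at_right 0) (\<lambda>t. ereal (thr_ratio \<nu> t))
     \<and> (\<forall>c::real. c > 0 \<longrightarrow>
          lower_quant_dim0 \<nu> = liminf (\<lambda>N. ereal (thr_ratio \<nu> (real N powr (- c)))) \<and>
          upper_quant_dim0 \<nu> = limsup (\<lambda>N. ereal (thr_ratio \<nu> (real N powr (- c)))))"
proof -
  interpret prob_space \<nu> by fact
  interpret dyadic_decay \<nu> a C
  proof
    show "AE x in \<nu>. x \<in> root_cube"
      using AE_in_msupport[OF assms(2)] assms(3) interior_subset[of "root_cube :: (real ^ 'n) set"]
      by (auto elim!: eventually_mono)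
    show "prob (cube_at k x) \<le> C * 2 powr (- a * real k)" if "x \<in> root_cube" for k x
      using that assms(6) by (simp add: dyadic_cubes_eq)
  qed (use assms in auto)
  show ?thesis
    unfolding Let_def
  proof (intro conjI allI impI; (elim conjE)?)
    show "1 \<le> card_const CARD('n)" by (rule card_const_ge_1)
    fix t :: real assume t: "0 < t" "t < 1"
    show "finite (thr_partition \<nu> t)"
      "real (thr_card \<nu> t) \<le> card_const CARD('n) * (1 / t) * (1 + log 2 (1 / t))"
      by (rule finite_thr_partition_card_le[OF t])+
  next
    fix C1 t :: real
    assume C1: "1 \<le> C1" and t: "0 < t" "t < 1"
      and card: "\<forall>t. 0 < t \<and> t < 1 \<longrightarrow> real (thr_card \<nu> t) \<le> C1 * (1 / t) * (1 + log 2 (1 / t))"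
    have card_t: "real (thr_card \<nu> t) \<le> C1 * (1 / t) * (1 + log 2 (1 / t))" using card t by blast
    show "log 2 (1 / t) \<le> thr_entropy \<nu> t" by (rule log_le_thr_entropy[OF t])
    show "thr_entropy \<nu> t \<le> log 2 (real (thr_card \<nu> t))" by (rule thr_entropy_le_log_card[OF t])
    show "log 2 (real (thr_card \<nu> t)) \<le> log 2 (1 / t) + log 2 (C1 * (1 + log 2 (1 / t)))"
      by (rule log_thr_card_le[OF t C1 card_t])
    show "0 \<le> thr_ratio \<nu> t - log 2 (1 / t) / thr_lyapunov \<nu> t"
      "thr_ratio \<nu> t - log 2 (1 / t) / thr_lyapunov \<nu> t
        \<le> real CARD('n) * (log 2 (C1 * (1 + log 2 (1 / t))) / log 2 (1 / t))"
      by (rule thr_ratio_diff_bounds[OF t C1 card_t])+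
  qed (rule thr_ratio_error_tendsto_0 quant_dim0_eq_thr_ratio quant_dim0_eq_thr_ratio_powr; assumption?)+
qed

end
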